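(* Let $\mathcal B= (Q, L, \lambda, \rho)$ be a bi-reversible automaton. For an invertible automaton $\mathcal D$, let $n_{\mathcal D}$ denote the order of the permutation group $\Sigma_{\mathcal D}$ generated by $\mathcal D$; thus $n_{\mathcal B}$ is the order of $\Sigma_{\mathcal B} = \langle \lambda(q, \cdot) \mid q \in Q\rangle\leq \mathrm{Sym}(L)$. Let also $\Gamma_{\mathcal B}$ be the group defined by the presentation $$\Gamma_{\mathcal B} = \langle Q \sqcup L \mid q\,\lambda(q, \ell) = \ell\, \rho(q, \ell) \ \ \forall (q, \ell ) \in Q \times L\rangle.$$ Suppose that $\gamma_Q, \gamma_L \in \Gamma_{\mathcal B}$ are elements that belong respectively to the subgroups of $\Gamma_{\mathcal B}$ generated by $Q$ and $L$, and that $\varphi\colon \Gamma_{\mathcal B} \to H$ is a homomorphism to a group $H$ satisfying the following conditions: (i) $\varphi(\gamma_Q)$ and $\varphi(\gamma_L)$ do not commute. (ii) The order of $\varphi(\gamma_Q)$ is finite, and relatively prime to $n_{\mathcal B}\, n_{((\mathcal B^* )^{-1})^*}$. (iii) The order of $\varphi(\gamma_L)$ is finite, and relatively prime to $n_{\mathcal B^*}\, n_{(\mathcal B^{-1})^*}$. Then the groups $G_{\mathcal B}$ and $G_{\mathcal B^*}$ defined by the automaton $\mathcal B$ and its dual $\mathcal B^*$ both contain non-abelian free semigroups. In particular they have exponential growth, and contain elements of infinite order.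
   Context: A Mealy automaton is a tuple $\mathcal B=(Q,L,\lambda,\rho)$ consisting of finite sets $Q$ (states) and $L$ (alphabet), and maps $\lambda\colon Q\times L\to L$ (output map) and $\rho\colon Q\times L\to Q$ (transition map). It is invertible if for all $q\in Q$ the map $L\to L:\ell\mapsto\lambda(q,\ell)$ is a bijection; reversible if for all $\ell\in L$ the map $Q\to Q: q\mapsto\rho(q,\ell)$ is a bijection; bi-reversible if it is both invertible and reversible and moreover the map $Q\times L\to L\times Q:(q,\ell)\mapsto(\lambda(q,\ell),\rho(q,\ell))$ is a bijection. The dual automaton is $\mathcal B^*=(L,Q,\rho\circ\tau,\lambda\circ\tau)$, where $\tau\colon L\times Q\to Q\times L$ swaps the coordinates; so its states are $L$, its alphabet is $Q$, its output map is $(\ell,q)\mapsto\rho(q,\ell)$ and its transition map is $(\ell,q)\mapsto\lambda(q,\ell)$. If $\mathcal B$ is invertible, the inverse automaton $\mathcal B^{-1}$ has set of states a set $Q^{-1}=\{q^{-1}\mid q\in Q\}$ in bijection with $Q$, alphabet $L$, and output and transition maps determined by: on input $\lambda(q,\ell)$ in state $q^{-1}$, the output is $\ell$ and the next state is $\rho(q,\ell)^{-1}$. When $\mathcal B$ is bi-reversible, all of $\mathcal B$, $\mathcal B^*$, $(\mathcal B^{-1})^*$ and $((\mathcal B^* )^{-1})^*$ are invertible. For an invertible automaton $\mathcal D$ with states $Q'$, alphabet $L'$ and output map $\lambda'$, $\Sigma_{\mathcal D}=\langle\lambda'(q,\cdot)\mid q\in Q'\rangle\le\mathrm{Sym}(L')$.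 The automaton group $G_{\mathcal D}$ is the group of permutations of the free monoid on $L'$ (vertices of a regular rooted tree) generated by the states $q\in Q'$, acting recursively by fixing the empty word and $q(\ell w)=\lambda'(q,\ell)\,\big(\rho'(q,\ell)(w)\big)$ for $\ell\in L'$ and $w$ a word, where $\rho'$ is the transition map. *)

theory Defs
  imports "HOL-Algebra.Bij" "HOL-Algebra.Elementary_Groups" "HOL-Algebra.Multiplicative_Group"
begin

section \<open>Mealy automata\<close>

record ('q, 'l) mealy =
  states :: "'q set"
  alphabet :: "'l set"
  out_letter :: "'q \<Rightarrow> 'l \<Rightarrow> 'l"
  next_state :: "'q \<Rightarrow> 'l \<Rightarrow> 'q"

text \<open>The values of the two maps outside \<open>states A \<times> alphabet A\<close> are irrelevant.\<close>

definition mealy_automaton :: "('q, 'l) mealy \<Rightarrow> bool" where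
  "mealy_automaton A \<longleftrightarrow> finite (states A) \<and> finite (alphabet A)
     \<and> (\<forall>q\<in>states A. \<forall>l\<in>alphabet A. out_letter A q l \<in> alphabet A \<and> next_state A q l \<in> states A)"

definition invertible_automaton :: "('q, 'l) mealy \<Rightarrow> bool" where
  "invertible_automaton A \<longleftrightarrow> mealy_automaton A
     \<and> (\<forall>q\<in>states A. bij_betw (\<lambda>l. out_letter A q l) (alphabet A) (alphabet A))"

definition reversible_automaton :: "('q, 'l) mealy \<Rightarrow> bool" where
  "reversible_automaton A \<longleftrightarrow> mealy_automaton A
     \<and> (\<forall>l\<in>alphabet A. bij_betw (\<lambda>q. next_state A q l) (states A) (states A))"

definition bireversible_automaton :: "('q, 'l) mealy \<Rightarrow> bool" where
  "bireversible_automaton A \<longleftrightarrow> invertible_automaton A \<and> reversible_automaton A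
     \<and> bij_betw (\<lambda>(q, l). (out_letter A q l, next_state A q l))
         (states A \<times> alphabet A) (alphabet A \<times> states A)"

definition dual_automaton :: "('q, 'l) mealy \<Rightarrow> ('l, 'q) mealy" where
  "dual_automaton A = \<lparr>states = alphabet A, alphabet = states A,
     out_letter = (\<lambda>l q. next_state A q l), next_state = (\<lambda>l q. out_letter A q l)\<rparr>"

text \<open>The states of the inverse automaton are formal inverses \<open>q\<inverse>\<close> of states \<open>q\<close>.\<close>

datatype 'q inv_state = Inv (orig_state: 'q)

definition inverse_automaton :: "('q, 'l) mealy \<Rightarrow> ('q inv_state, 'l) mealy" where
  "inverse_automaton A = \<lparr>states = Inv ` states A, alphabet = alphabet A,
     out_letter = (\<lambda>p m. inv_into (alphabet A) (out_letter A (orig_state p)) m),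
     next_state = (\<lambda>p m. Inv (next_state A (orig_state p)
        (inv_into (alphabet A) (out_letter A (orig_state p)) m)))\<rparr>"

lemma inverse_automaton_rules:
  assumes "invertible_automaton A" "q \<in> states A" "l \<in> alphabet A"
  shows "out_letter (inverse_automaton A) (Inv q) (out_letter A q l) = l"
    and "next_state (inverse_automaton A) (Inv q) (out_letter A q l) = Inv (next_state A q l)"
  using assms
  by (auto simp: inverse_automaton_def invertible_automaton_def bij_betw_def)

lemma dual_invertible_iff: "invertible_automaton (dual_automaton A) \<longleftrightarrow> reversible_automaton A"
  by (auto simp: dual_automaton_def invertible_automaton_def reversible_automaton_def
      mealy_automaton_def)

lemma dual_reversible_iff: "reversible_automaton (dual_automaton A) \<longleftrightarrow> invertible_automaton A"
  by (auto simp: dual_automaton_def invertible_automaton_def reversible_automaton_def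
      mealy_automaton_def)

lemma dual_bireversible:
  assumes "bireversible_automaton A"
  shows "bireversible_automaton (dual_automaton A)"
proof -
  let ?f = "\<lambda>(q, l). (out_letter A q l, next_state A q l)"
  have "bij_betw ?f (states A \<times> alphabet A) (alphabet A \<times> states A)"
    using assms by (simp add: bireversible_automaton_def)
  moreover have "bij_betw prod.swap (alphabet A \<times> states A) (states A \<times> alphabet A)"
    by (auto simp: bij_betw_def inj_on_def image_def)
  moreover have "bij_betw prod.swap (alphabet A \<times> states A) (states A \<times> alphabet A)"
    by (auto simp: bij_betw_def inj_on_def image_def)
  ultimately have "bij_betw (prod.swap \<circ> (?f \<circ> prod.swap))
      (alphabet A \<times> states A) (states A \<times> alphabet A)"
    by (meson bij_betw_trans)
  moreover have "prod.swap \<circ> (?f \<circ> prod.swap) = (\<lambda>(l, q). (next_state A q l, out_letter A q l))"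
    by (auto simp: fun_eq_iff)
  ultimately show ?thesis
    using assms unfolding bireversible_automaton_def dual_reversible_iff dual_invertible_iff
    by (simp add: dual_automaton_def)
qed

lemma inverse_mealy:
  assumes "invertible_automaton A"
  shows "mealy_automaton (inverse_automaton A)"
proof -
  have "inv_into (alphabet A) (out_letter A q) m \<in> alphabet A"
    if "q \<in> states A" "m \<in> alphabet A" for q m
    using assms that by (metis bij_betw_def inv_into_into invertible_automaton_def)
  then show ?thesis
    using assms by (simp add: inverse_automaton_def invertible_automaton_def mealy_automaton_def)
qed

lemma inverse_reversible:
  assumes "bireversible_automaton A"
  shows "reversible_automaton (inverse_automaton A)"
proof -
  have i: "invertible_automaton A" and r: "reversible_automaton A"
    and f: "inj_on (\<lambda>(q, l). (out_letter A q l, next_state A q l)) (states A \<times> alphabet A)"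
    using assms by (auto simp: bireversible_automaton_def bij_betw_def)
  let ?I = "inverse_automaton A"
  have m: "mealy_automaton ?I" using inverse_mealy[OF i] .
  have st: "states ?I = Inv ` states A" "alphabet ?I = alphabet A"
    by (auto simp: inverse_automaton_def)
  have "bij_betw (\<lambda>p. next_state ?I p l) (states ?I) (states ?I)" if l: "l \<in> alphabet A" for l
  proof -
    have "inj_on (\<lambda>p. next_state ?I p l) (states ?I)"
    proof (rule inj_onI)
      fix p p' assume p: "p \<in> states ?I" "p' \<in> states ?I"
        and eq: "next_state ?I p l = next_state ?I p' l"
      obtain q q' where q: "p = Inv q" "p' = Inv q'" "q \<in> states A" "q' \<in> states A"
        using p st by auto
      obtain k where k: "k \<in> alphabet A" "l = out_letter A q k"
        using i q l unfolding invertible_automaton_def bij_betw_def by blast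
      obtain k' where k': "k' \<in> alphabet A" "l = out_letter A q' k'"
        using i q l unfolding invertible_automaton_def bij_betw_def by blast
      have "next_state A q k = next_state A q' k'"
        using eq inverse_automaton_rules(2)[OF i] q k k' by (metis inv_state.inject)
      then have "(q, k) = (q', k')"
        using inj_onD[OF f, of "(q, k)" "(q', k')"] q k k' by simp
      then show "p = p'" using q by simp
    qed
    moreover have "(\<lambda>p. next_state ?I p l) ` states ?I \<subseteq> states ?I"
      using m l st unfolding mealy_automaton_def by auto
    ultimately show ?thesis
      using m unfolding mealy_automaton_def bij_betw_def by (metis endo_inj_surj)
  qed
  then show ?thesis using m st unfolding reversible_automaton_def by auto
qed

lemma bireversible_associated_invertible:
  assumes "bireversible_automaton A"
  shows "invertible_automaton A"
    and "invertible_automaton (dual_automaton A)"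
    and "invertible_automaton (dual_automaton (inverse_automaton A))"
    and "invertible_automaton (dual_automaton (inverse_automaton (dual_automaton A)))"
  using assms dual_bireversible[OF assms]
  by (auto simp: dual_invertible_iff inverse_reversible bireversible_automaton_def)


section \<open>Groups attached to an automaton\<close>

definition perm_group :: "('q, 'l) mealy \<Rightarrow> ('l \<Rightarrow> 'l) monoid" where
  "perm_group A = subgroup_generated (BijGroup (alphabet A))
     ((\<lambda>q. restrict (out_letter A q) (alphabet A)) ` states A)"

definition perm_order :: "('q, 'l) mealy \<Rightarrow> nat" where
  "perm_order A = order (perm_group A)"

fun action :: "('q, 'l) mealy \<Rightarrow> 'q \<Rightarrow> 'l list \<Rightarrow> 'l list" where
  "action A q [] = []"
| "action A q (l # w) = out_letter A q l # action A (next_state A q l) w"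

definition automaton_group :: "('q, 'l) mealy \<Rightarrow> ('l list \<Rightarrow> 'l list) monoid" where
  "automaton_group A = subgroup_generated (BijGroup (lists (alphabet A)))
     ((\<lambda>q. restrict (action A q) (lists (alphabet A))) ` states A)"

text \<open>
  \<^term>\<open>subgroup_generated\<close> discards generators outside the ambient group; for invertible
  automata nothing is discarded.
\<close>

lemma output_in_BijGroup:
  assumes "invertible_automaton A" "q \<in> states A"
  shows "restrict (out_letter A q) (alphabet A) \<in> carrier (BijGroup (alphabet A))"
  using assms by (auto simp: BijGroup_def Bij_def invertible_automaton_def)

lemma action_in_lists:
  assumes "mealy_automaton A" "q \<in> states A" "w \<in> lists (alphabet A)"
  shows "action A q w \<in> lists (alphabet A)"
  using assms(2,3)
proof (induction w arbitrary: q)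
  case (Cons l w)
  then show ?case using assms(1) by (auto simp: mealy_automaton_def)
qed simp

lemma bij_betw_action:
  assumes "invertible_automaton A" "q \<in> states A"
  shows "bij_betw (action A q) (lists (alphabet A)) (lists (alphabet A))"
proof -
  have m: "mealy_automaton A" using assms(1) by (simp add: invertible_automaton_def)
  have inj: "v = w" if "q \<in> states A" "v \<in> lists (alphabet A)" "w \<in> lists (alphabet A)"
      "action A q v = action A q w" for q v w
    using that
  proof (induction v arbitrary: q w)
    case Nil
    then show ?case by (cases w) auto
  next
    case (Cons l v)
    then obtain k u where w: "w = k # u" by (cases w) auto
    have "l = k"
      using Cons.prems w assms(1) by (auto simp: invertible_automaton_def bij_betw_def inj_on_def)
    moreover have "next_state A q l \<in> states A"
      using Cons.prems m by (auto simp: mealy_automaton_def)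
    ultimately show ?case using Cons.IH[of "next_state A q l" u] Cons.prems w by auto
  qed
  have surj: "\<exists>v\<in>lists (alphabet A). action A q v = w"
    if "q \<in> states A" "w \<in> lists (alphabet A)" for q w
    using that
  proof (induction w arbitrary: q)
    case Nil
    then show ?case by (intro bexI[of _ "[]"]) auto
  next
    case (Cons l w)
    then have "l \<in> out_letter A q ` alphabet A"
      using assms(1) by (auto simp: invertible_automaton_def bij_betw_def)
    then obtain k where k: "k \<in> alphabet A" "out_letter A q k = l" by blast
    have "next_state A q k \<in> states A"
      using Cons.prems m k by (auto simp: mealy_automaton_def)
    then obtain v where "v \<in> lists (alphabet A)" "action A (next_state A q k) v = w"
      using Cons by auto
    then show ?case using k by (intro bexI[of _ "k # v"]) auto
  qed
  show ?thesis
    unfolding bij_betw_def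
  proof (intro conjI subset_antisym subsetI)
    show "inj_on (action A q) (lists (alphabet A))"
      using inj[OF assms(2)] by (rule inj_onI)
    show "w \<in> lists (alphabet A)" if "w \<in> action A q ` lists (alphabet A)" for w
      using that action_in_lists[OF m assms(2)] by blast
    show "w \<in> action A q ` lists (alphabet A)" if "w \<in> lists (alphabet A)" for w
      using surj[OF assms(2) that] by blast
  qed
qed

lemma action_in_BijGroup:
  assumes "invertible_automaton A" "q \<in> states A"
  shows "restrict (action A q) (lists (alphabet A)) \<in> carrier (BijGroup (lists (alphabet A)))"
  using bij_betw_action[OF assms] by (auto simp: BijGroup_def Bij_def)


section \<open>Groups given by generators and relations\<close>

text \<open>
  A letter \<open>(x, True)\<close> stands for the generator \<open>x\<close>, and \<open>(x, False)\<close> for its formal inverse.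
  The group presented by \<open>X\<close> and a set \<open>R\<close> of relations \<open>u = v\<close> consists of the words in these
  letters, modulo the least congruence that contains \<open>R\<close> and makes the two letters attached to
  each generator inverse to each other.
\<close>

type_synonym 'x gword = "('x \<times> bool) list"

inductive pres_eq :: "'x set \<Rightarrow> ('x gword \<times> 'x gword) set \<Rightarrow> 'x gword \<Rightarrow> 'x gword \<Rightarrow> bool"
  for X :: "'x set" and R :: "('x gword \<times> 'x gword) set" where
  refl: "w \<in> lists (X \<times> UNIV) \<Longrightarrow> pres_eq X R w w"
| sym: "pres_eq X R u v \<Longrightarrow> pres_eq X R v u"
| trans: "pres_eq X R u v \<Longrightarrow> pres_eq X R v w \<Longrightarrow> pres_eq X R u w"
| append: "pres_eq X R u u' \<Longrightarrow> pres_eq X R v v' \<Longrightarrow> pres_eq X R (u @ v) (u' @ v')"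
| cancel: "x \<in> X \<Longrightarrow> pres_eq X R [(x, b), (x, \<not> b)] []"
| rel: "(u, v) \<in> R \<Longrightarrow> u \<in> lists (X \<times> UNIV) \<Longrightarrow> v \<in> lists (X \<times> UNIV) \<Longrightarrow> pres_eq X R u v"

definition pres_class :: "'x set \<Rightarrow> ('x gword \<times> 'x gword) set \<Rightarrow> 'x gword \<Rightarrow> 'x gword set" where
  "pres_class X R w = {v. pres_eq X R w v}"

definition presented_group ::
    "'x set \<Rightarrow> ('x gword \<times> 'x gword) set \<Rightarrow> 'x gword set monoid" where
  "presented_group X R = \<lparr>carrier = pres_class X R ` lists (X \<times> UNIV),
     mult = (\<lambda>C D. \<Union>u\<in>C. \<Union>v\<in>D. pres_class X R (u @ v)),
     one = pres_class X R []\<rparr>"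

lemma pres_eq_in_lists:
  assumes "pres_eq X R u v"
  shows "u \<in> lists (X \<times> UNIV)" and "v \<in> lists (X \<times> UNIV)"
proof -
  have "u \<in> lists (X \<times> UNIV) \<and> v \<in> lists (X \<times> UNIV)"
    using assms by (induction rule: pres_eq.induct) simp_all
  then show "u \<in> lists (X \<times> UNIV)" "v \<in> lists (X \<times> UNIV)" by simp_all
qed

lemma pres_class_eq_iff:
  assumes "u \<in> lists (X \<times> UNIV)"
  shows "pres_class X R u = pres_class X R v \<longleftrightarrow> pres_eq X R u v"
proof
  assume "pres_class X R u = pres_class X R v"
  then have "pres_eq X R v u"
    using pres_eq.refl[OF assms] unfolding pres_class_def by blast
  then show "pres_eq X R u v" by (rule pres_eq.sym)
next
  assume "pres_eq X R u v"
  then have "pres_eq X R u w \<longleftrightarrow> pres_eq X R v w" for w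
    by (meson pres_eq.sym pres_eq.trans)
  then show "pres_class X R u = pres_class X R v"
    by (simp add: pres_class_def)
qed

lemma presented_group_mult:
  assumes "u \<in> lists (X \<times> UNIV)" "v \<in> lists (X \<times> UNIV)"
  shows "pres_class X R u \<otimes>\<^bsub>presented_group X R\<^esub> pres_class X R v = pres_class X R (u @ v)"
proof -
  have "pres_class X R (u' @ v') = pres_class X R (u @ v)"
    if "u' \<in> pres_class X R u" "v' \<in> pres_class X R v" for u' v'
  proof -
    have "pres_eq X R (u @ v) (u' @ v')"
      using that by (auto simp: pres_class_def intro: pres_eq.append)
    then show ?thesis
      using pres_class_eq_iff[of "u @ v" X R "u' @ v'"] assms by simp
  qed
  moreover have "u \<in> pres_class X R u" "v \<in> pres_class X R v"
    using assms by (auto simp: pres_class_def intro: pres_eq.refl)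
  ultimately have "(\<Union>u'\<in>pres_class X R u. \<Union>v'\<in>pres_class X R v. pres_class X R (u' @ v'))
      = pres_class X R (u @ v)"
    by blast
  then show ?thesis by (simp add: presented_group_def)
qed

lemma pres_eq_inverse:
  assumes "w \<in> lists (X \<times> UNIV)"
  shows "pres_eq X R (rev (map (\<lambda>(x, b). (x, \<not> b)) w) @ w) []"
  using assms
proof (induction w rule: lists.induct)
  case Nil
  then show ?case by (simp add: pres_eq.refl)
next
  case (Cons a w)
  obtain x b where a: "a = (x, b)" by fastforce
  let ?i = "rev (map (\<lambda>(x, b). (x, \<not> b)) w)"
  have w: "w \<in> lists (X \<times> UNIV)" "?i \<in> lists (X \<times> UNIV)" "x \<in> X"
    using Cons.hyps a by (auto simp: in_lists_conv_set)
  have "pres_eq X R [(x, \<not> b), (x, b)] []"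
    using pres_eq.cancel[OF w(3), of R "\<not> b"] by simp
  then have "pres_eq X R ([(x, \<not> b), (x, b)] @ w) ([] @ w)"
    by (rule pres_eq.append) (rule pres_eq.refl[OF w(1)])
  then have "pres_eq X R (?i @ ([(x, \<not> b), (x, b)] @ w)) (?i @ ([] @ w))"
    by (rule pres_eq.append[OF pres_eq.refl[OF w(2)]])
  moreover have "pres_eq X R (?i @ w) []" using Cons.IH .
  ultimately have "pres_eq X R (?i @ ([(x, \<not> b), (x, b)] @ w)) []"
    unfolding append_Nil by (rule pres_eq.trans)
  then show ?case using a by simp
qed

theorem group_presented_group: "group (presented_group X R)"
proof (rule groupI)
  let ?G = "presented_group X R"
  have car: "carrier ?G = pres_class X R ` lists (X \<times> UNIV)"
    and one: "\<one>\<^bsub>?G\<^esub> = pres_class X R []"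
    by (simp_all add: presented_group_def)
  show "\<one>\<^bsub>?G\<^esub> \<in> carrier ?G" by (simp add: car one)
  fix C assume "C \<in> carrier ?G"
  then obtain u where u: "u \<in> lists (X \<times> UNIV)" "C = pres_class X R u" using car by auto
  show "\<one>\<^bsub>?G\<^esub> \<otimes>\<^bsub>?G\<^esub> C = C"
    using u(1) unfolding u(2) one by (simp add: presented_group_mult)
  let ?i = "rev (map (\<lambda>(x, b). (x, \<not> b)) u)"
  have i: "?i \<in> lists (X \<times> UNIV)" using u by (auto simp: in_lists_conv_set)
  have "pres_class X R ?i \<otimes>\<^bsub>?G\<^esub> C = \<one>\<^bsub>?G\<^esub>"
    unfolding u(2) one presented_group_mult[OF i u(1)]
    using pres_class_eq_iff[OF pres_eq_in_lists(1)] pres_eq_inverse[OF u(1)] by metis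
  then show "\<exists>D\<in>carrier ?G. D \<otimes>\<^bsub>?G\<^esub> C = \<one>\<^bsub>?G\<^esub>" using i car by blast
  fix D assume "D \<in> carrier ?G"
  then obtain v where v: "v \<in> lists (X \<times> UNIV)" "D = pres_class X R v" using car by auto
  show "C \<otimes>\<^bsub>?G\<^esub> D \<in> carrier ?G"
    using u(1) v(1) unfolding u(2) v(2) by (simp add: presented_group_mult car)
  fix E assume "E \<in> carrier ?G"
  then obtain w where w: "w \<in> lists (X \<times> UNIV)" "E = pres_class X R w" using car by auto
  show "C \<otimes>\<^bsub>?G\<^esub> D \<otimes>\<^bsub>?G\<^esub> E = C \<otimes>\<^bsub>?G\<^esub> (D \<otimes>\<^bsub>?G\<^esub> E)"
    using u(1) v(1) w(1) unfolding u(2) v(2) w(2)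
    by (simp add: presented_group_mult)
qed

text \<open>The group \<open>\<Gamma>\<^sub>A\<close>, on the disjoint union of the states and the letters of \<open>A\<close>.\<close>

definition gamma_gens :: "('q, 'l) mealy \<Rightarrow> ('q + 'l) set" where
  "gamma_gens A = Inl ` states A \<union> Inr ` alphabet A"

definition gamma_rels :: "('q, 'l) mealy \<Rightarrow> (('q + 'l) gword \<times> ('q + 'l) gword) set" where
  "gamma_rels A = {([(Inl q, True), (Inr (out_letter A q l), True)],
                    [(Inr l, True), (Inl (next_state A q l), True)])
     | q l. q \<in> states A \<and> l \<in> alphabet A}"

definition gamma_group :: "('q, 'l) mealy \<Rightarrow> ('q + 'l) gword set monoid" where
  "gamma_group A = presented_group (gamma_gens A) (gamma_rels A)"

definition gamma_gen :: "('q, 'l) mealy \<Rightarrow> 'q + 'l \<Rightarrow> ('q + 'l) gword set" where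
  "gamma_gen A x = pres_class (gamma_gens A) (gamma_rels A) [(x, True)]"

lemma group_gamma_group: "group (gamma_group A)"
  by (simp add: gamma_group_def group_presented_group)

lemma gamma_gen_in_carrier:
  assumes "x \<in> gamma_gens A"
  shows "gamma_gen A x \<in> carrier (gamma_group A)"
proof -
  have "[(x, True)] \<in> lists (gamma_gens A \<times> UNIV)" using assms by simp
  then show ?thesis by (simp add: gamma_gen_def gamma_group_def presented_group_def)
qed

lemma gamma_relation:
  assumes "mealy_automaton A" "q \<in> states A" "l \<in> alphabet A"
  shows "gamma_gen A (Inl q) \<otimes>\<^bsub>gamma_group A\<^esub> gamma_gen A (Inr (out_letter A q l))
    = gamma_gen A (Inr l) \<otimes>\<^bsub>gamma_group A\<^esub> gamma_gen A (Inl (next_state A q l))"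
proof -
  let ?X = "gamma_gens A" and ?R = "gamma_rels A"
  let ?u = "[(Inl q, True), (Inr (out_letter A q l), True)]"
  let ?v = "[(Inr l, True), (Inl (next_state A q l), True)]"
  have m: "out_letter A q l \<in> alphabet A" "next_state A q l \<in> states A"
    using assms by (auto simp: mealy_automaton_def)
  have g: "Inl q \<in> ?X" "Inr (out_letter A q l) \<in> ?X" "Inr l \<in> ?X" "Inl (next_state A q l) \<in> ?X"
    using assms m by (auto simp: gamma_gens_def)
  then have u: "?u \<in> lists (?X \<times> UNIV)" and v: "?v \<in> lists (?X \<times> UNIV)"
    by simp_all
  have "(?u, ?v) \<in> ?R" using assms by (auto simp: gamma_rels_def)
  then have "pres_class ?X ?R ?u = pres_class ?X ?R ?v"
    using pres_class_eq_iff[OF u] pres_eq.rel[OF _ u v] by simp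
  then show ?thesis
    using g by (simp add: gamma_gen_def gamma_group_def presented_group_mult)
qed


section \<open>Free semigroups and growth\<close>

definition list_prod :: "('a, 'b) monoid_scheme \<Rightarrow> 'a list \<Rightarrow> 'a" where
  "list_prod G xs = foldr (\<otimes>\<^bsub>G\<^esub>) xs \<one>\<^bsub>G\<^esub>"

definition semigroup_generated :: "('a, 'b) monoid_scheme \<Rightarrow> 'a set \<Rightarrow> 'a set" where
  "semigroup_generated G S = list_prod G ` (lists S - {[]})"

definition freely_generates_semigroup :: "('a, 'b) monoid_scheme \<Rightarrow> 'a set \<Rightarrow> bool" where
  "freely_generates_semigroup G S \<longleftrightarrow> S \<subseteq> carrier G \<and> inj_on (list_prod G) (lists S - {[]})"

definition contains_nonabelian_free_semigroup :: "('a, 'b) monoid_scheme \<Rightarrow> bool" where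
  "contains_nonabelian_free_semigroup G \<longleftrightarrow> (\<exists>S. freely_generates_semigroup G S
     \<and> (\<exists>x\<in>semigroup_generated G S. \<exists>y\<in>semigroup_generated G S. x \<otimes>\<^bsub>G\<^esub> y \<noteq> y \<otimes>\<^bsub>G\<^esub> x))"

definition finite_generating_set :: "('a, 'b) monoid_scheme \<Rightarrow> 'a set \<Rightarrow> bool" where
  "finite_generating_set G S \<longleftrightarrow> finite S \<and> S \<subseteq> carrier G \<and> generate G S = carrier G"

definition word_ball :: "('a, 'b) monoid_scheme \<Rightarrow> 'a set \<Rightarrow> nat \<Rightarrow> 'a set" where
  "word_ball G S n = list_prod G ` {w \<in> lists (S \<union> m_inv G ` S). length w \<le> n}"

text \<open>
  Whether the growth is exponential does not depend on the choice of a finite generating set.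
  Since ball sizes are submultiplicative, \<open>lim |word_ball G S n|\<^sup>1\<^sup>/\<^sup>n > 1\<close> holds iff some \<open>c > 1\<close>
  satisfies \<open>|word_ball G S n| \<ge> c\<^sup>n\<close> for all \<open>n\<close>.
\<close>

definition exponential_growth :: "('a, 'b) monoid_scheme \<Rightarrow> bool" where
  "exponential_growth G \<longleftrightarrow> (\<exists>S. finite_generating_set G S)
     \<and> (\<forall>S. finite_generating_set G S \<longrightarrow>
          (\<exists>c::real. c > 1 \<and> (\<forall>n. real (card (word_ball G S n)) \<ge> c ^ n)))"

text \<open>\<^term>\<open>group.ord G x = 0\<close> means that \<open>x\<close> has infinite order.\<close>

definition contains_infinite_order_element :: "('a, 'b) monoid_scheme \<Rightarrow> bool" where
  "contains_infinite_order_element G \<longleftrightarrow> (\<exists>g\<in>carrier G. group.ord G g = 0)"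

end

theory Submission
  imports Defs
begin

text \<open>
  Suppose that \<open>\<gamma>\<^sub>Q\<close> had finite order in the automaton group. The orders of the words of states
  acting on words of letters only involve primes dividing the order of the local permutation
  group, so some power of \<open>\<gamma>\<^sub>Q\<close> with exponent prime to the order of \<open>\<phi> \<gamma>\<^sub>Q\<close> would act trivially.
  Conjugation by \<open>\<gamma>\<^sub>L\<close> permutes the finitely many trivially acting words of given length, and its
  orbits have lengths prime to the order of \<open>\<phi> \<gamma>\<^sub>L\<close>; so \<open>\<phi> \<gamma>\<^sub>Q\<close> and \<open>\<phi> \<gamma>\<^sub>L\<close> would commute.

  An element \<open>a\<close> of infinite order yields a free semigroup because the automaton is reversible:
  taking the states of a suitable power automaton as letters, the residuals of the powers of \<open>a\<close>
  form a subshift of finite type on whose words of each length the input words act transitively.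
  By transitivity, the number of first letters among the allowed paths that equal a given path in
  the group (with the same end points) depends only on the length of the path. If this number
  reaches the number of all allowed first letters, long paths can be normalised, the powers of \<open>a\<close>
  have boundedly many residuals in the group, and \<open>a\<close> is torsion. Otherwise there are two loops at a
  common vertex whose products never coincide.
\<close>

section \<open>Words of states acting on words of letters\<close>

text \<open>The first state of \<open>u\<close> acts first, so concatenation of words is composition
  in the opposite order.\<close>

definition word_action :: "('q, 'l) mealy \<Rightarrow> 'q list \<Rightarrow> 'l list \<Rightarrow> 'l list" where
  "word_action A u w = fold (action A) u w"

lemma dual_dual [simp]: "dual_automaton (dual_automaton A) = A"
  by (simp add: dual_automaton_def)

lemma dual_simps [simp]:
  "states (dual_automaton A) = alphabet A" "alphabet (dual_automaton A) = states A"
  "out_letter (dual_automaton A) l q = next_state A q l"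
  "next_state (dual_automaton A) l q = out_letter A q l"
  by (simp_all add: dual_automaton_def)

lemma length_action [simp]: "length (action A q w) = length w"
  by (induction w arbitrary: q) auto

lemma word_action_Nil [simp]: "word_action A [] w = w"
  by (simp add: word_action_def)

lemma word_action_Cons: "word_action A (q # u) w = word_action A u (action A q w)"
  by (simp add: word_action_def)

lemma word_action_append: "word_action A (u @ v) w = word_action A v (word_action A u w)"
  by (simp add: word_action_def)

lemma length_word_action [simp]: "length (word_action A u w) = length w"
  by (induction u arbitrary: w) (auto simp: word_action_Cons)

lemma word_action_empty [simp]: "word_action A u [] = []"
  using length_word_action[of A u "[]"] by (simp del: length_word_action)

text \<open>While \<open>u\<close> transforms the letter \<open>l\<close>, this letter travels
  through \<open>u\<close> as a state of the dual automaton. Hence the residual of \<open>u\<close>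
  at \<open>l\<close>, the word acting on what follows \<open>l\<close>, is the dual action of
  \<open>l\<close> on \<open>u\<close>.\<close>

lemma word_action_Cons2:
  "word_action A u (l # w) =
     fold (out_letter A) u l # word_action A (action (dual_automaton A) l u) w"
  by (induction u arbitrary: l w) (auto simp: word_action_Cons)

lemma word_action_single: "word_action A u [l] = [fold (out_letter A) u l]"
  by (simp add: word_action_Cons2)

lemma word_action_append2:
  "word_action A u (w @ w') =
     word_action A u w @ word_action A (word_action (dual_automaton A) w u) w'"
  by (induction w arbitrary: u) (auto simp: word_action_Cons word_action_Cons2)

text \<open>This is the splitting rule for the dual automaton: the second factor \<open>v\<close>
  reads the output of \<open>u\<close> on \<open>w\<close>, not \<open>w\<close> itself.\<close>

lemma residual_append:
  "word_action (dual_automaton A) w (u @ v) =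
     word_action (dual_automaton A) w u @ word_action (dual_automaton A) (word_action A u w) v"
  using word_action_append2[of "dual_automaton A" w u v] by simp

lemma concat_replicate_single: "concat (replicate n [x]) = replicate n x"
  by (induction n) auto

lemma concat_replicate_replicate: "concat (replicate m (replicate n x)) = replicate (n * m) x"
  by (induction m) (simp_all add: replicate_add)

lemma word_action_concat_replicate:
  "word_action A (concat (replicate n u)) w = (word_action A u ^^ n) w"
  by (induction n arbitrary: w) (auto simp: word_action_append funpow_swap1)

lemma word_action_in_lists:
  assumes "mealy_automaton A" "u \<in> lists (states A)" "w \<in> lists (alphabet A)"
  shows "word_action A u w \<in> lists (alphabet A)"
  using assms(2,3)
proof (induction u arbitrary: w)
  case (Cons q u)
  then have "action A q w \<in> lists (alphabet A)"
    by (intro action_in_lists[OF assms(1)]) auto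
  then show ?case using Cons by (simp only: word_action_Cons Cons_in_lists_iff)
qed simp

lemma dual_mealy: "mealy_automaton A \<Longrightarrow> mealy_automaton (dual_automaton A)"
  by (auto simp: mealy_automaton_def)

lemma invertible_mealy: "invertible_automaton A \<Longrightarrow> mealy_automaton A"
  by (simp add: invertible_automaton_def)

lemma bij_word_action:
  assumes "invertible_automaton A" "u \<in> lists (states A)"
  shows "bij_betw (word_action A u) (lists (alphabet A)) (lists (alphabet A))"
  using assms(2)
proof (induction u)
  case Nil
  then show ?case using bij_betw_id by (simp add: bij_betw_def inj_on_def)
next
  case (Cons q u)
  have "word_action A (q # u) = word_action A u \<circ> action A q"
    by (auto simp: word_action_Cons)
  moreover have "bij_betw (word_action A u) (lists (alphabet A)) (lists (alphabet A))"
    using Cons by simp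
  moreover have "bij_betw (action A q) (lists (alphabet A)) (lists (alphabet A))"
    using Cons bij_betw_action[OF assms(1)] by simp
  ultimately show ?case by (metis bij_betw_trans)
qed

text \<open>Two powers of \<open>f\<close> agree on the finite set by the pigeonhole principle, and
  injectivity cancels the smaller one.\<close>

lemma bij_betw_finite_order:
  assumes "finite S" "bij_betw f S S"
  shows "\<exists>N>0. \<forall>x\<in>S. (f ^^ N) x = x"
proof -
  let ?r = "\<lambda>n. restrict (f ^^ n) S"
  have m: "(f ^^ n) x \<in> S" if "x \<in> S" for n x
    using that assms(2) by (induction n) (auto simp: bij_betw_def)
  have "range ?r \<subseteq> S \<rightarrow>\<^sub>E S" using m by auto
  then have "finite (range ?r)" using assms(1) by (meson finite_PiE finite_subset)
  then have "\<not> inj ?r" using finite_imageD infinite_UNIV_nat by blast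
  then obtain i j where ij: "?r i = ?r j" "i < j"
    unfolding inj_def by (metis nat_neq_iff)
  have "(f ^^ (j - i)) x = x" if x: "x \<in> S" for x
  proof -
    have "(f ^^ i) ((f ^^ (j - i)) x) = (f ^^ i) x"
      using fun_cong[OF ij(1), of x] x ij(2)
      by (simp add: funpow_add[symmetric, THEN fun_cong, simplified])
    moreover have "inj_on (f ^^ i) S"
      using assms(2) bij_betw_funpow bij_betw_def by metis
    ultimately show ?thesis using m x inj_onD by metis
  qed
  then show ?thesis using ij(2) by (intro exI[of _ "j - i"]) simp
qed

lemma word_action_finite_order:
  assumes "invertible_automaton A" "u \<in> lists (states A)"
  shows "\<exists>N>0. \<forall>w\<in>lists (alphabet A). length w \<le> d \<longrightarrow>
       word_action A (concat (replicate N u)) w = w"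
proof -
  let ?S = "{w. set w \<subseteq> alphabet A \<and> length w \<le> d}"
  have fin: "finite ?S"
    using invertible_mealy[OF assms(1)]
    by (simp add: finite_lists_length_le mealy_automaton_def)
  have inj: "inj_on (word_action A u) ?S"
    by (rule inj_on_subset[OF bij_betw_imp_inj_on[OF bij_word_action[OF assms]]])
      (auto simp: lists_eq_set)
  have "word_action A u ` ?S \<subseteq> ?S"
    using word_action_in_lists[OF invertible_mealy[OF assms(1)] assms(2)]
    by (auto simp: lists_eq_set)
  then have "bij_betw (word_action A u) ?S ?S"
    using fin inj by (simp add: bij_betw_def endo_inj_surj)
  from bij_betw_finite_order[OF fin this] show ?thesis
    by (auto simp: word_action_concat_replicate lists_eq_set)
qed

section \<open>Equality of words of states as maps of the tree\<close>

definition word_equiv :: "('q, 'l) mealy \<Rightarrow> 'q list \<Rightarrow> 'q list \<Rightarrow> bool" where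
  "word_equiv A u v \<longleftrightarrow> (\<forall>w\<in>lists (alphabet A). word_action A u w = word_action A v w)"

lemma word_equiv_refl [simp]: "word_equiv A u u"
  by (simp add: word_equiv_def)

lemma word_equiv_sym: "word_equiv A u v \<Longrightarrow> word_equiv A v u"
  by (simp add: word_equiv_def)

lemma word_equiv_trans: "word_equiv A u v \<Longrightarrow> word_equiv A v w \<Longrightarrow> word_equiv A u w"
  by (simp add: word_equiv_def)

lemma word_equiv_append:
  assumes "mealy_automaton A" "u \<in> lists (states A)"
    "word_equiv A u u'" "word_equiv A v v'"
  shows "word_equiv A (u @ v) (u' @ v')"
  using assms word_action_in_lists[OF assms(1,2)]
  by (simp del: in_lists_conv_set add: word_equiv_def word_action_append)

lemma word_equiv_cancel_left:
  assumes "invertible_automaton A" "u \<in> lists (states A)" "word_equiv A (u @ v) (u @ v')"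
  shows "word_equiv A v v'"
  unfolding word_equiv_def
proof
  fix w assume "w \<in> lists (alphabet A)"
  then obtain w' where "w' \<in> lists (alphabet A)" "w = word_action A u w'"
    using bij_word_action[OF assms(1,2)] by (metis bij_betw_imp_surj_on imageE)
  then show "word_action A v w = word_action A v' w"
    using assms(3) by (simp add: word_equiv_def word_action_append)
qed

lemma word_equiv_cancel_right:
  assumes "invertible_automaton A" "u \<in> lists (states A)" "v \<in> lists (states A)"
    "v' \<in> lists (states A)" "word_equiv A (v @ u) (v' @ u)"
  shows "word_equiv A v v'"
  unfolding word_equiv_def
proof
  fix w assume w: "w \<in> lists (alphabet A)"
  have "word_action A v w \<in> lists (alphabet A)" "word_action A v' w \<in> lists (alphabet A)"
    using word_action_in_lists[OF invertible_mealy[OF assms(1)]] assms w by auto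
  moreover have "word_action A u (word_action A v w) = word_action A u (word_action A v' w)"
    using assms(5) w by (simp add: word_equiv_def word_action_append)
  ultimately show "word_action A v w = word_action A v' w"
    using bij_word_action[OF assms(1,2)] by (meson bij_betw_imp_inj_on inj_onD)
qed

text \<open>Comparing the two words on \<open>w @ w'\<close>, the part of the output after
  \<open>w\<close> is the action of the residuals on \<open>w'\<close>.\<close>

lemma word_equiv_residual:
  assumes "word_equiv A u v" "w \<in> lists (alphabet A)"
  shows "word_equiv A (word_action (dual_automaton A) w u) (word_action (dual_automaton A) w v)"
  unfolding word_equiv_def
proof
  fix w' assume "w' \<in> lists (alphabet A)"
  then have "word_action A u (w @ w') = word_action A v (w @ w')"
    using assms by (simp add: word_equiv_def)
  then show "word_action A (word_action (dual_automaton A) w u) w'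
      = word_action A (word_action (dual_automaton A) w v) w'"
    by (simp add: word_action_append2)
qed

section \<open>Residuals of the powers of a state\<close>

text \<open>The element studied is a single state; a word is brought into this form later by
  \<open>power_automaton\<close>. Reversibility is expressed through the dual, so that letters
  permute the words of states of each length.\<close>

locale reversible_state =
  fixes A :: "('q, 'l) mealy" and a :: 'q
  assumes inv: "invertible_automaton A"
    and rev: "invertible_automaton (dual_automaton A)"
    and a_state: "a \<in> states A"
begin

abbreviation act :: "'q list \<Rightarrow> 'l list \<Rightarrow> 'l list" where
  "act u w \<equiv> word_action A u w"

abbreviation res :: "'q list \<Rightarrow> 'l list \<Rightarrow> 'q list" where
  "res u w \<equiv> word_action (dual_automaton A) w u"

abbreviation equiv_word (infix "\<approx>" 50) where
  "u \<approx> v \<equiv> word_equiv A u v"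

text \<open>The set turns out to be closed under factors and extendable on both sides, so it is the
  language of a subshift.\<close>

definition lang :: "'q list set" where
  "lang = {res (replicate n a) w | w n. w \<in> lists (alphabet A)}"

definition ext :: "'q list \<Rightarrow> 'q set" where
  "ext u = {x. u @ [x] \<in> lang}"

lemma finite_states: "finite (states A)" and finite_alphabet: "finite (alphabet A)"
  using inv by (simp_all add: invertible_automaton_def mealy_automaton_def)

lemma replicate_in_states: "replicate n a \<in> lists (states A)"
  using a_state by (auto simp: in_lists_conv_set)

lemma act_in: "u \<in> lists (states A) \<Longrightarrow> w \<in> lists (alphabet A) \<Longrightarrow> act u w \<in> lists (alphabet A)"
  using word_action_in_lists[OF invertible_mealy[OF inv]] .

lemma res_in: "u \<in> lists (states A) \<Longrightarrow> w \<in> lists (alphabet A) \<Longrightarrow> res u w \<in> lists (states A)"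
  using word_action_in_lists[OF invertible_mealy[OF rev]] by simp

lemma act_surj:
  assumes "u \<in> lists (states A)" "w \<in> lists (alphabet A)"
  obtains w' where "w' \<in> lists (alphabet A)" "act u w' = w"
  using bij_word_action[OF inv assms(1)] assms(2) by (metis bij_betw_imp_surj_on imageE)

lemma res_inj:
  assumes "u \<in> lists (states A)" "v \<in> lists (states A)" "w \<in> lists (alphabet A)" "res u w = res v w"
  shows "u = v"
proof -
  have "inj_on (word_action (dual_automaton A) w) (lists (states A))"
    using bij_word_action[OF rev, of w] assms(3) by (simp add: bij_betw_def)
  from inj_onD[OF this assms(4,1,2)] show ?thesis .
qed

lemma res_res: "res (res u w) w' = res u (w @ w')"
  by (simp add: word_action_append)

text \<open>By reversibility some power of \<open>w\<close> fixes all words of bounded length;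
  repeating \<open>w\<close> the remaining number of times undoes its effect.\<close>

lemma res_return:
  assumes "u \<in> lists (states A)" "w \<in> lists (alphabet A)"
  obtains w' where "w' \<in> lists (alphabet A)" "res (res u w) w' = u"
proof -
  have w: "w \<in> lists (states (dual_automaton A))" using assms by simp
  obtain M where M: "\<forall>v\<in>lists (states A). length v \<le> length u \<longrightarrow>
      res v (concat (replicate (Suc M) w)) = v"
    using word_action_finite_order[OF rev w, of "length u"]
    by (metis dual_simps(2) gr0_conv_Suc)
  have "concat (replicate M w) \<in> lists (alphabet A)"
    using assms(2) by (auto simp: in_lists_conv_set)
  moreover have "res (res u w) (concat (replicate M w)) = u"
    using M assms(1) by (simp add: word_action_append)
  ultimately show thesis using that by blast
qed

lemma lang_states: "lang \<subseteq> lists (states A)"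
  using res_in[OF replicate_in_states] by (auto simp: lang_def simp del: in_lists_conv_set)

lemma lang_replicate: "replicate n a \<in> lang"
proof -
  have "replicate n a = res (replicate n a) []" "[] \<in> lists (alphabet A)" by simp_all
  then show ?thesis unfolding lang_def by blast
qed

lemma lang_res: "u \<in> lang \<Longrightarrow> w \<in> lists (alphabet A) \<Longrightarrow> res u w \<in> lang"
proof -
  assume "u \<in> lang" and w: "w \<in> lists (alphabet A)"
  then obtain n w' where w': "u = res (replicate n a) w'" "w' \<in> lists (alphabet A)"
    unfolding lang_def by blast
  then have "res u w = res (replicate n a) (w' @ w)" by (simp add: res_res)
  moreover have "w' @ w \<in> lists (alphabet A)" using w w' by simp
  ultimately show "res u w \<in> lang" unfolding lang_def by blast
qed

lemma lang_eq: "u \<in> lang \<Longrightarrow> \<exists>w\<in>lists (alphabet A). u = res (replicate (length u) a) w"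
  by (auto simp: lang_def simp del: in_lists_conv_set)

text \<open>One returns from \<open>u\<close> to the power of \<open>a\<close> and goes on to
  \<open>v\<close> from there.\<close>

lemma lang_trans:
  assumes "u \<in> lang" "v \<in> lang" "length u = length v"
  obtains w where "w \<in> lists (alphabet A)" "res u w = v"
proof -
  obtain w1 where w1: "w1 \<in> lists (alphabet A)" "u = res (replicate (length u) a) w1"
    using lang_eq[OF assms(1)] by blast
  obtain w2 where w2: "w2 \<in> lists (alphabet A)" "v = res (replicate (length u) a) w2"
    using lang_eq[OF assms(2)] assms(3) by auto
  obtain w3 where "w3 \<in> lists (alphabet A)" "res u w3 = replicate (length u) a"
    using res_return[OF replicate_in_states w1(1)] w1(2) by metis
  then have "w3 @ w2 \<in> lists (alphabet A)" "res u (w3 @ w2) = v"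
    using w2 by (simp_all add: res_res[symmetric])
  then show thesis using that by blast
qed

text \<open>A power of \<open>a\<close> splits into two powers of \<open>a\<close>; the residual of
  the second is taken at the output of the first, which is again a word over the alphabet.\<close>

lemma lang_append:
  assumes "u @ v \<in> lang"
  shows lang_prefix: "u \<in> lang" and lang_suffix: "v \<in> lang"
proof -
  obtain w where w: "w \<in> lists (alphabet A)"
    "u @ v = res (replicate (length u) a @ replicate (length v) a) w"
    using lang_eq[OF assms] by (auto simp: replicate_add simp del: in_lists_conv_set)
  let ?u = "res (replicate (length u) a) w"
  let ?v = "res (replicate (length v) a) (act (replicate (length u) a) w)"
  have "u @ v = ?u @ ?v" using w(2) by (simp add: residual_append)
  then have "u = ?u" "v = ?v" by (auto simp: append_eq_append_conv)
  moreover have "?u \<in> lang" "?v \<in> lang"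
    using lang_res[OF lang_replicate] act_in[OF replicate_in_states] w(1) by blast+
  ultimately show "u \<in> lang" "v \<in> lang" by auto
qed

lemma lang_extend_right:
  assumes "u \<in> lang"
  obtains t where "length t = n" "u @ t \<in> lang"
proof -
  obtain w where w: "w \<in> lists (alphabet A)" "u = res (replicate (length u) a) w"
    using lang_eq[OF assms] by blast
  have "res (replicate (length u + n) a) w \<in> lang" using lang_res[OF lang_replicate w(1)] .
  then show thesis
    using that[of "res (replicate n a) (act (replicate (length u) a) w)"] w(2)
    by (simp add: replicate_add residual_append)
qed

text \<open>The added block must pass exactly the input \<open>w\<close> on to the old one;
  bijectivity of the action of \<open>a\<close> supplies a preimage of \<open>w\<close>.\<close>

lemma lang_extend_left:
  assumes "u \<in> lang"
  obtains t where "length t = n" "t @ u \<in> lang"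
proof -
  obtain w where w: "w \<in> lists (alphabet A)" "u = res (replicate (length u) a) w"
    using lang_eq[OF assms] by blast
  obtain w' where w': "w' \<in> lists (alphabet A)" "act (replicate n a) w' = w"
    using act_surj[OF replicate_in_states w(1)] by blast
  have "res (replicate (n + length u) a) w' \<in> lang" using lang_res[OF lang_replicate w'(1)] .
  then show thesis
    using that[of "res (replicate n a) w'"] w(2) w'(2) by (simp add: replicate_add residual_append)
qed

lemma ext_states: "ext u \<subseteq> states A"
  using lang_states by (auto simp: ext_def)

lemma finite_ext: "finite (ext u)"
  using ext_states finite_states finite_subset by metis

text \<open>An input carrying \<open>u\<close> to \<open>v\<close> also moves the letter following
  \<open>u\<close>, and does so injectively by reversibility. This embeds the extensions of
  \<open>u\<close> into those of \<open>v\<close>.\<close>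

lemma card_ext_le:
  assumes "u \<in> lang" "v \<in> lang" "length u = length v"
  shows "card (ext u) \<le> card (ext v)"
proof -
  obtain w where w: "w \<in> lists (alphabet A)" "res u w = v" using lang_trans[OF assms] .
  have u: "u \<in> lists (states A)" using assms lang_states by auto
  let ?f = "\<lambda>x. hd (res [x] (act u w))"
  have f: "res [x] (act u w) = [?f x]" for x
    using length_word_action[of "dual_automaton A" "act u w" "[x]"]
    by (cases "res [x] (act u w)") (auto simp del: length_word_action)
  have "?f ` ext u \<subseteq> ext v"
  proof
    fix y assume "y \<in> ?f ` ext u"
    then obtain x where x: "x \<in> ext u" "y = ?f x" by blast
    then have "res (u @ [x]) w \<in> lang" using lang_res[OF _ w(1)] by (simp add: ext_def)
    moreover have "res (u @ [x]) w = v @ [y]" using f[of x] x(2) w(2) by (simp add: residual_append)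
    ultimately show "y \<in> ext v" by (simp add: ext_def)
  qed
  moreover have "inj_on ?f (ext u)"
  proof (rule inj_onI)
    fix x y assume xy: "x \<in> ext u" "y \<in> ext u" "?f x = ?f y"
    then have "res [x] (act u w) = res [y] (act u w)" using f by metis
    moreover have "[x] \<in> lists (states A)" "[y] \<in> lists (states A)"
      using xy ext_states by auto
    ultimately have "[x] = [y]" using res_inj act_in[OF u w(1)] by blast
    then show "x = y" by simp
  qed
  ultimately show ?thesis using finite_ext card_inj_on_le by blast
qed

lemma card_ext_eq:
  assumes "u \<in> lang" "v \<in> lang" "length u = length v"
  shows "card (ext u) = card (ext v)"
  using card_ext_le assms by (metis le_antisym)

lemma ext_suffix: "ext (u @ v) \<subseteq> ext v"
  using lang_suffix by (auto simp: ext_def)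

text \<open>The number of extensions of a word depends only on its length and does not increase with
  it, so it is eventually constant.\<close>

lemma ext_stabilises:
  obtains n0 where "\<And>u v. u @ v \<in> lang \<Longrightarrow> length v = n0 \<Longrightarrow> ext (u @ v) = ext v"
proof -
  let ?r = "\<lambda>n. card (ext (replicate n a))"
  obtain n0 where n0: "\<And>n. ?r n0 \<le> ?r n"
    using ex_has_least_nat[of "\<lambda>_. True" 0 ?r] by blast
  have "ext (u @ v) = ext v" if uv: "u @ v \<in> lang" "length v = n0" for u v
  proof (rule card_seteq[OF finite_ext ext_suffix])
    have "card (ext v) = ?r n0"
      using card_ext_eq[OF lang_suffix[OF uv(1)] lang_replicate] uv(2) by simp
    also have "\<dots> \<le> ?r (length (u @ v))" using n0 .
    also have "\<dots> = card (ext (u @ v))" using card_ext_eq[OF uv(1) lang_replicate] length_replicate by metis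
    finally show "card (ext v) \<le> card (ext (u @ v))" .
  qed
  then show thesis using that by blast
qed

text \<open>The maps given by the \<open>lang\<close> words of one length \<open>N\<close> are at
  most \<open>C\<close> in number, and residuals of such words are again such words. The decreasing
  chain of those maps that fix all words of length at most \<open>d\<close> has two equal
  consecutive terms at some \<open>d \<le> C\<close>, and a map at that stage fixes
  everything.\<close>

lemma lang_bounded_torsion:
  assumes "\<And>N. N \<ge> m \<Longrightarrow> card ((\<lambda>z. restrict (act z) (lists (alphabet A))) ` {z \<in> lang. length z = N}) \<le> C"
  shows "\<exists>N>0. replicate N a \<approx> []"
proof -
  let ?W = "lists (alphabet A)"
  let ?cls = "\<lambda>z. restrict (act z) ?W"
  obtain N0 where N0: "N0 > 0"
    "\<forall>w\<in>?W. length w \<le> C \<longrightarrow> act (concat (replicate N0 [a])) w = w"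
    using word_action_finite_order[OF inv, of "[a]" C] a_state by auto
  \<comment> \<open>A multiple of \<open>N0\<close>, so that this power of \<open>a\<close> fixes
    all words of length at most \<open>C\<close>, and large enough for the assumed bound.\<close>
  define N where "N = N0 * Suc m"
  have rN: "replicate N a = concat (replicate (Suc m) (replicate N0 a))"
    unfolding N_def concat_replicate_replicate ..
  have triv: "act (replicate N a) w = w" if "w \<in> ?W" "length w \<le> C" for w
  proof -
    have "act (replicate N0 a) w = w" using N0 that by (simp add: concat_replicate_single)
    then have "(act (replicate N0 a) ^^ k) w = w" for k by (induction k) auto
    then show ?thesis unfolding rN word_action_concat_replicate by blast
  qed
  let ?Z = "{z \<in> lang. length z = N}"
  define T where "T d = {c \<in> ?cls ` ?Z. \<forall>w\<in>?W. length w \<le> d \<longrightarrow> c w = w}" for d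
  have "finite {z. set z \<subseteq> states A \<and> length z = N}"
    using finite_states by (rule finite_lists_length_eq)
  moreover have "?Z \<subseteq> {z. set z \<subseteq> states A \<and> length z = N}"
    using lang_states by (auto simp: lists_eq_set)
  ultimately have fin: "finite (?cls ` ?Z)" by (meson finite_imageI finite_subset)
  then have finT: "finite (T d)" for d by (simp add: T_def)
  have mN: "m \<le> N" unfolding N_def using N0(1) by (cases N0) auto
  have "card (T 0) \<le> card (?cls ` ?Z)" by (rule card_mono[OF fin]) (auto simp: T_def)
  then have cardT: "card (T 0) \<le> C" using assms[OF mN] by simp
  have dec: "T (Suc d) \<subseteq> T d" for d by (auto simp: T_def)
  \<comment> \<open>A chain starting with at most \<open>C\<close> elements cannot drop strictly
    \<open>C + 1\<close> times.\<close>
  have "\<exists>d\<le>C. T (Suc d) = T d"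
  proof (rule ccontr)
    assume "\<not> ?thesis"
    then have less: "card (T (Suc d)) < card (T d)" if "d \<le> C" for d
      using that dec finT by (metis psubset_card_mono psubsetI)
    have "card (T d) + d \<le> C" if "d \<le> Suc C" for d
      using that
    proof (induction d)
      case (Suc d)
      then show ?case using less[of d] by simp
    qed (use cardT in simp)
    from this[of "Suc C"] show False by simp
  qed
  then obtain d where d: "d \<le> C" "T (Suc d) = T d" by blast
  have fix_all: "act z w = w" if "w \<in> ?W" "z \<in> ?Z" "?cls z \<in> T d" for w z
    using that
  proof (induction w arbitrary: z)
    case (Cons l w)
    have l: "[l] \<in> ?W" and w: "w \<in> ?W" using Cons.hyps by auto
    have z: "act z w' = w'" if "w' \<in> ?W" "length w' \<le> Suc d" for w'
    proof -
      have "?cls z \<in> T (Suc d)" unfolding d(2) by (rule Cons.prems(2))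
      then have "?cls z w' = w'" using that by (simp only: T_def) blast
      then show ?thesis using that by (simp del: in_lists_conv_set)
    qed
    \<comment> \<open>Fixing the words of length up to \<open>Suc d\<close> means fixing
      \<open>l\<close> and having a residual at \<open>l\<close> that fixes the words of length up
      to \<open>d\<close>. The residual is thus again in \<open>T d\<close>, and the induction
      continues.\<close>
    let ?z = "res z [l]"
    have zl: "act z [l] = [l]" using z[OF l] by simp
    have "?z \<in> ?Z" using Cons.prems lang_res[OF _ l] by simp
    moreover have "act ?z w' = w'" if w': "w' \<in> ?W" "length w' \<le> d" for w'
    proof -
      have "act z ([l] @ w') = [l] @ w'" using w' l by (intro z) auto
      then show ?thesis using zl by (simp only: word_action_append2) simp
    qed
    ultimately have "?cls ?z \<in> T d" unfolding T_def by (auto simp del: in_lists_conv_set)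
    then have "act ?z w = w" using Cons.IH[OF \<open>?z \<in> ?Z\<close>] by blast
    then have "act z ([l] @ w) = [l] @ w" using zl by (simp only: word_action_append2)
    then show ?case by simp
  qed simp
  have rZ: "replicate N a \<in> ?Z" using lang_replicate by simp
  then have "?cls (replicate N a) \<in> T d"
    unfolding T_def using triv d(1) by (auto simp del: in_lists_conv_set)
  then have "replicate N a \<approx> []"
    using fix_all rZ by (simp add: word_equiv_def del: in_lists_conv_set)
  then show ?thesis using N0(1) by (intro exI[of _ N]) (simp add: N_def)
qed

end

section \<open>The subshift as paths in a finite graph\<close>

locale stable_state = reversible_state A a for A :: "('q, 'l) mealy" and a :: 'q +
  fixes n0 :: nat
  assumes ext_stable: "\<And>u v. u @ v \<in> lang \<Longrightarrow> length v = n0 \<Longrightarrow> ext (u @ v) = ext v"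
begin

text \<open>The last \<open>n0\<close> letters of a word determine which letters may follow. So
  words of length \<open>n0\<close> are the vertices of a finite graph, and a continuation is valid
  whatever path led to the vertex \<open>e\<close>.\<close>

lemma lang_splice:
  assumes "p @ e \<in> lang" "e @ y \<in> lang" "length e = n0"
  shows "p @ e @ y \<in> lang"
  using assms(2)
proof (induction y rule: rev_induct)
  case Nil
  then show ?case using assms(1) by simp
next
  case (snoc x y)
  have ey: "e @ y \<in> lang" using lang_prefix[of "e @ y" "[x]"] snoc.prems by simp
  then have pey: "p @ e @ y \<in> lang" using snoc.IH by simp
  define s where "s = take (length y) (e @ y)"
  define t where "t = drop (length y) (e @ y)"
  have st: "e @ y = s @ t" "length t = n0"
    unfolding s_def t_def using assms(3) by (simp_all only: append_take_drop_id) simp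
  have "ext (e @ y) = ext t" using ext_stable[of s t] ey st by simp
  moreover have "ext (p @ e @ y) = ext t" using ext_stable[of "p @ s" t] pey st by simp
  moreover have "x \<in> ext (e @ y)" using snoc.prems by (simp add: ext_def)
  ultimately have "x \<in> ext (p @ e @ y)" by simp
  then show ?case by (simp add: ext_def)
qed

text \<open>For a vertex \<open>v\<close>, a word \<open>z\<close> with \<open>v @ z\<close> in
  \<open>lang\<close> is a path from \<open>v\<close>, and \<open>drop (length z) (v @ z)\<close> is
  its final vertex. The set collects the first steps of all paths with the same length and end
  points that equal \<open>z\<close> as maps. For empty \<open>z\<close> only the unspecified value
  \<open>hd []\<close> could occur, hence the hypotheses \<open>z \<noteq> []\<close> below.\<close>

definition first_letters :: "'q list \<Rightarrow> 'q list \<Rightarrow> 'q set" where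
  "first_letters v z = {x. \<exists>z'. x = hd z' \<and> length z' = length z \<and> v @ z' \<in> lang \<and> z' \<approx> z
      \<and> drop (length z) (v @ z') = drop (length z) (v @ z)}"

text \<open>Equal paths share their final vertex, so the same continuation \<open>y\<close> can be
  spliced onto each of them.\<close>

lemma first_letters_mono:
  assumes "v @ z @ y \<in> lang" "length v = n0" "z \<noteq> []"
  shows "first_letters v z \<subseteq> first_letters v (z @ y)"
proof
  fix x assume "x \<in> first_letters v z"
  then obtain z' where z': "x = hd z'" "length z' = length z" "v @ z' \<in> lang" "z' \<approx> z"
    "drop (length z) (v @ z') = drop (length z) (v @ z)"
    unfolding first_letters_def by blast
  define e where "e = drop (length z) (v @ z)"
  have e: "v @ z = take (length z) (v @ z) @ e" "v @ z' = take (length z) (v @ z') @ e"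
    "length e = n0"
    using z' assms(2) append_take_drop_id[of "length z" "v @ z"]
      append_take_drop_id[of "length z" "v @ z'"] by (auto simp: e_def)
  have "e @ y \<in> lang"
    using assms(1) e(1) lang_suffix[of "take (length z) (v @ z)" "e @ y"]
    by (metis append.assoc)
  then have "take (length z) (v @ z') @ e @ y \<in> lang"
    using lang_splice[of "take (length z) (v @ z')" e y] z'(3) e by metis
  then have "v @ z' @ y \<in> lang" using e(2) by (metis append.assoc)
  moreover have "z' \<in> lists (states A)"
    using lang_states z'(3) by auto
  then have "z' @ y \<approx> z @ y"
    using word_equiv_append[OF invertible_mealy[OF inv]] z'(4) by auto
  moreover have "drop (length z) (v @ z' @ y) = drop (length z) (v @ z @ y)"
    using z'(2,5) assms(2)
    by (metis append.assoc drop_append length_append)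
  then have "drop (length (z @ y)) (v @ z' @ y) = drop (length (z @ y)) (v @ z @ y)"
    by (metis drop_drop length_append add.commute)
  moreover have "x = hd (z' @ y)" using z' assms(3) by (cases z') auto
  ultimately show "x \<in> first_letters v (z @ y)"
    unfolding first_letters_def using z'(2) by (auto intro!: exI[of _ "z' @ y"])
qed

lemma first_letters_ext:
  assumes "z \<noteq> []"
  shows "first_letters v z \<subseteq> ext v"
proof
  fix x assume "x \<in> first_letters v z"
  then obtain z' where z': "x = hd z'" "length z' = length z" "v @ z' \<in> lang"
    unfolding first_letters_def by blast
  then have "z' = x # tl z'" using assms by (cases z') auto
  then have "(v @ [x]) @ tl z' \<in> lang" using z'(3) by simp
  from lang_prefix[OF this] show "x \<in> ext v" by (simp add: ext_def)
qed

text \<open>An input transports paths to paths, and equality of maps passes to residuals. The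
  delicate point is that the transported paths still end at a common vertex.\<close>

lemma first_letters_res:
  assumes "v @ z \<in> lang" "w \<in> lists (alphabet A)" "length v = n0" "z \<noteq> []" "x \<in> first_letters v z"
  shows "hd (res [x] (act v w)) \<in> first_letters (res v w) (res z (act v w))"
proof -
  obtain z' where z': "x = hd z'" "length z' = length z" "v @ z' \<in> lang" "z' \<approx> z"
    "drop (length z) (v @ z') = drop (length z) (v @ z)"
    using assms(5) unfolding first_letters_def by blast
  have vs: "v \<in> lists (states A)" "z \<in> lists (states A)" "z' \<in> lists (states A)"
    using assms(1) z'(3) lang_states by auto
  let ?w = "act v w"
  have w: "?w \<in> lists (alphabet A)" using act_in[OF vs(1) assms(2)] .
  have 1: "res v w @ res z' ?w \<in> lang"
    using lang_res[OF z'(3) assms(2)] by (simp add: residual_append)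
  have 2: "res z' ?w \<approx> res z ?w"
    using word_equiv_residual[OF z'(4) w] .
  define e where "e = drop (length z) (v @ z)"
  define p where "p = take (length z) (v @ z)"
  define p' where "p' = take (length z) (v @ z')"
  have pe: "v @ z = p @ e" "v @ z' = p' @ e"
    unfolding p_def p'_def e_def using z'(5) by (metis append_take_drop_id)+
  have pl: "length p = length z" "length p' = length z"
    using z'(2) by (simp_all add: p_def p'_def)
  have pes: "p \<in> lists (states A)" "p' \<in> lists (states A)" "e \<in> lists (states A)"
    using vs pe(1,2) by (metis append_in_lists_conv)+
  \<comment> \<open>Both paths end with the same \<open>n0\<close> letters \<open>e\<close>.
    Cancelling \<open>e\<close> leaves equal maps \<open>p\<close> and \<open>p'\<close>, so
    \<open>e\<close> reads the same input after either of them and has the same residual.\<close>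
  have "v @ z' \<approx> v @ z"
    using word_equiv_append[OF invertible_mealy[OF inv] vs(1) word_equiv_refl z'(4)] .
  then have "p' \<approx> p"
    using word_equiv_cancel_right[OF inv pes(3,2,1)] pe by simp
  then have "act p' w = act p w" using assms(2) by (simp add: word_equiv_def)
  then have "drop (length z) (res (v @ z') w) = drop (length z) (res (v @ z) w)"
    unfolding pe residual_append using pl by simp
  then have 3: "drop (length z) (res v w @ res z' ?w) = drop (length z) (res v w @ res z ?w)"
    by (simp add: residual_append)
  have "z' = [x] @ tl z'" using z' assms(4) by (cases z') auto
  then have "res z' ?w = res [x] ?w @ res (tl z') (act [x] ?w)"
    by (metis residual_append)
  moreover have "length (res [x] ?w) = 1" by simp
  ultimately have 4: "hd (res z' ?w) = hd (res [x] ?w)"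
    by (metis hd_append list.size(3) zero_neq_one)
  show ?thesis
    unfolding first_letters_def using 1 2 3 4 z'(2)
    by (auto intro!: exI[of _ "res z' ?w"])
qed

text \<open>Some input carries \<open>v @ z\<close> to \<open>v' @ z'\<close>, and it moves first
  letters injectively. By symmetry the cardinality depends only on the length of the path.\<close>

lemma card_first_letters_le:
  assumes "v @ z \<in> lang" "v' @ z' \<in> lang" "length v = n0" "length v' = n0"
    "length z = length z'" "z \<noteq> []"
  shows "card (first_letters v z) \<le> card (first_letters v' z')"
proof -
  obtain w where w: "w \<in> lists (alphabet A)" "res (v @ z) w = v' @ z'"
    using lang_trans[OF assms(1,2)] assms by auto
  have vs: "v \<in> lists (states A)" using assms(1) lang_states by auto
  have vz: "res v w = v'" "res z (act v w) = z'"
    using w(2) assms(3,4) by (simp_all add: residual_append append_eq_append_conv)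
  let ?f = "\<lambda>x. hd (res [x] (act v w))"
  have f: "res [x] (act v w) = [?f x]" for x
    using length_word_action[of "dual_automaton A" "act v w" "[x]"]
    by (cases "res [x] (act v w)") (auto simp del: length_word_action)
  have "?f ` first_letters v z \<subseteq> first_letters v' z'"
    using first_letters_res[OF assms(1) w(1) assms(3,6)] vz by auto
  moreover have "inj_on ?f (first_letters v z)"
  proof (rule inj_onI)
    fix x y assume xy: "x \<in> first_letters v z" "y \<in> first_letters v z" "?f x = ?f y"
    then have "res [x] (act v w) = res [y] (act v w)" using f by metis
    moreover have "[x] \<in> lists (states A)" "[y] \<in> lists (states A)"
      using xy first_letters_ext[OF assms(6)] ext_states by auto
    ultimately have "[x] = [y]" using res_inj act_in[OF vs w(1)] by blast
    then show "x = y" by simp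
  qed
  moreover have "finite (first_letters v' z')"
    using first_letters_ext[of z' v'] assms(5,6) finite_ext finite_subset by fastforce
  ultimately show ?thesis using card_inj_on_le by blast
qed

text \<open>Powers of \<open>a\<close> serve as reference paths; every path of the same positive
  length gives the same number.\<close>

definition num_first :: "nat \<Rightarrow> nat" where
  "num_first n = card (first_letters (replicate n0 a) (replicate n a))"

lemma card_first_letters:
  assumes "v @ z \<in> lang" "length v = n0" "z \<noteq> []"
  shows "card (first_letters v z) = num_first (length z)"
proof -
  have l: "replicate n0 a @ replicate (length z) a \<in> lang"
    using lang_replicate[of "n0 + length z"] by (simp add: replicate_add)
  show ?thesis
    unfolding num_first_def
    using card_first_letters_le[OF assms(1) l] card_first_letters_le[OF l assms(1)] assms
    by (simp add: le_antisym)
qed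

lemma card_ext_n0: "v \<in> lang \<Longrightarrow> length v = n0 \<Longrightarrow> card (ext v) = card (ext (replicate n0 a))"
  using card_ext_eq[OF _ lang_replicate[of n0]] by simp

lemma num_first_le: "0 < n \<Longrightarrow> num_first n \<le> card (ext (replicate n0 a))"
  unfolding num_first_def by (rule card_mono[OF finite_ext first_letters_ext]) simp

lemma num_first_mono:
  assumes "0 < m" "m \<le> n"
  shows "num_first m \<le> num_first n"
proof -
  have r: "replicate n a = replicate m a @ replicate (n - m) a"
    using assms by (simp add: replicate_add[symmetric])
  have "replicate n0 a @ replicate m a @ replicate (n - m) a \<in> lang"
    using lang_replicate[of "n0 + m + (n - m)"] by (simp add: replicate_add)
  then have "first_letters (replicate n0 a) (replicate m a) \<subseteq> first_letters (replicate n0 a) (replicate n a)"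
    unfolding r using first_letters_mono assms by simp
  moreover have "finite (first_letters (replicate n0 a) (replicate n a))"
    by (rule finite_subset[OF first_letters_ext finite_ext]) (use assms in simp)
  ultimately show ?thesis unfolding num_first_def by (simp add: card_mono)
qed

lemma num_first_max:
  obtains n1 where "n1 > 0" "\<And>n. n > 0 \<Longrightarrow> num_first n \<le> num_first n1"
proof -
  have "\<exists>n1. n1 > 0 \<and> (\<forall>n. n > 0 \<longrightarrow> num_first n \<le> num_first n1)"
    by (rule ex_has_greatest_nat[of _ 1 _ "Suc (card (ext (replicate n0 a)))"])
      (use num_first_le in \<open>simp_all add: less_Suc_eq_le\<close>)
  then show thesis using that by blast
qed

text \<open>When every allowed first letter is available, the first letter can be prescribed: fix
  one continuation \<open>x\<close> of \<open>v\<close>, replace a long path by an equal one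
  beginning with \<open>x\<close>, and repeat from the next vertex. The prefix \<open>c\<close>
  obtained in this way does not depend on \<open>z\<close>.\<close>

lemma collapse:
  assumes n1: "n1 > 0" "num_first n1 = card (ext (replicate n0 a))"
    and v: "v \<in> lang" "length v = n0"
  shows "\<exists>c. \<forall>z. v @ z \<in> lang \<longrightarrow> length z = k + n1 \<longrightarrow>
    (\<exists>y\<in>lists (states A). length y = n1 \<and> z \<approx> c @ y)"
  using v
proof (induction k arbitrary: v)
  case 0
  have "z \<in> lists (states A)" if "v @ z \<in> lang" for z
    using that lang_states by auto
  then show ?case by (intro exI[of _ "[]"]) (auto intro: word_equiv_refl)
next
  case (Suc k)
  obtain x where x: "v @ [x] \<in> lang"
    using lang_extend_right[OF Suc.prems(1), of 1] by (auto simp: length_Suc_conv)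
  \<comment> \<open>The next vertex drops the oldest letter and appends \<open>x\<close>; this form
    also covers \<open>n0 = 0\<close>, where \<open>v1\<close> is empty.\<close>
  define v1 where "v1 = tl (v @ [x])"
  have hd1: "v @ [x] = [hd (v @ [x])] @ v1" by (cases v) (auto simp: v1_def)
  have v1: "v1 \<in> lang" "length v1 = n0"
    using lang_suffix[of "[hd (v @ [x])]" v1] x hd1 Suc.prems by (auto simp: v1_def)
  obtain c where c: "\<And>z. v1 @ z \<in> lang \<Longrightarrow> length z = k + n1 \<Longrightarrow>
      \<exists>y\<in>lists (states A). length y = n1 \<and> z \<approx> c @ y"
    using Suc.IH[OF v1] by blast
  have "\<exists>y\<in>lists (states A). length y = n1 \<and> z \<approx> (x # c) @ y"
    if z: "v @ z \<in> lang" "length z = Suc k + n1" for z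
  proof -
    have zne: "z \<noteq> []" using z by auto
    have "card (ext v) \<le> card (first_letters v z)"
      using card_first_letters[OF z(1) Suc.prems(2) zne] card_ext_n0[OF Suc.prems] n1
        num_first_mono[of n1 "length z"] z(2) by simp
    then have "first_letters v z = ext v"
      using card_seteq[OF finite_ext first_letters_ext[OF zne]] by blast
    then have "x \<in> first_letters v z" using x by (simp add: ext_def)
    then obtain z' where z': "x = hd z'" "length z' = length z" "v @ z' \<in> lang" "z' \<approx> z"
      unfolding first_letters_def by blast
    then have zx: "z' = x # tl z'" using zne by (cases z') auto
    have "v @ [x] @ tl z' \<in> lang" using z'(3) zx by simp
    then have "[hd (v @ [x])] @ v1 @ tl z' \<in> lang" using hd1 by (metis append.assoc)
    then have "v1 @ tl z' \<in> lang" by (rule lang_suffix)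
    moreover have "length (tl z') = k + n1" using z' z by simp
    ultimately obtain y where y: "y \<in> lists (states A)" "length y = n1" "tl z' \<approx> c @ y"
      using c by blast
    have xs: "[x] \<in> lists (states A)" using x lang_states by auto
    have "[x] @ tl z' \<approx> [x] @ (c @ y)"
      by (rule word_equiv_append[OF invertible_mealy[OF inv] xs word_equiv_refl y(3)])
    then have "z' \<approx> (x # c) @ y" using zx by simp
    then have "z \<approx> (x # c) @ y" using z'(4) word_equiv_sym word_equiv_trans by blast
    then show ?thesis using y by blast
  qed
  then show ?case by blast
qed

text \<open>A normal form is determined by a starting vertex and a tail of length \<open>n1\<close>,
  so the number of maps is bounded independently of the length.\<close>

lemma collapse_torsion:
  assumes n1: "n1 > 0" "num_first n1 = card (ext (replicate n0 a))"
  shows "\<exists>N>0. replicate N a \<approx> []"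
proof (rule lang_bounded_torsion)
  let ?cls = "\<lambda>z. restrict (act z) (lists (alphabet A))"
  let ?V = "{v. set v \<subseteq> states A \<and> length v = n0}"
  let ?Y = "{y. set y \<subseteq> states A \<and> length y = n1}"
  fix N assume "n1 \<le> N"
  then obtain k where k: "N = k + n1" by (metis add.commute le_Suc_ex)
  obtain c where c: "\<And>v z. v \<in> lang \<Longrightarrow> length v = n0 \<Longrightarrow> v @ z \<in> lang \<Longrightarrow> length z = N \<Longrightarrow>
      \<exists>y\<in>lists (states A). length y = n1 \<and> z \<approx> c v @ y"
    using collapse[OF n1, of _ k] k by metis
  have finV: "finite ?V" and finY: "finite ?Y"
    using finite_lists_length_eq[OF finite_states] by auto
  have "?cls ` {z \<in> lang. length z = N} \<subseteq> (\<lambda>(v, y). ?cls (c v @ y)) ` (?V \<times> ?Y)"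
  proof
    fix f assume "f \<in> ?cls ` {z \<in> lang. length z = N}"
    then obtain z where z: "z \<in> lang" "length z = N" "f = ?cls z" by blast
    obtain v where v: "length v = n0" "v @ z \<in> lang" using lang_extend_left[OF z(1)] .
    have vl: "v \<in> lang" using lang_prefix[OF v(2)] .
    obtain y where y: "y \<in> lists (states A)" "length y = n1" "z \<approx> c v @ y"
      using c[OF vl v(1,2) z(2)] by blast
    have "f = ?cls (c v @ y)"
      unfolding z(3) using y(3) by (intro restrict_ext) (simp add: word_equiv_def)
    moreover have "v \<in> ?V" "y \<in> ?Y" using v vl y lang_states by (auto simp: lists_eq_set)
    ultimately show "f \<in> (\<lambda>(v, y). ?cls (c v @ y)) ` (?V \<times> ?Y)" by force
  qed
  then have "card (?cls ` {z \<in> lang. length z = N}) \<le> card ((\<lambda>(v, y). ?cls (c v @ y)) ` (?V \<times> ?Y))"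
    by (rule card_mono[rotated]) (use finV finY in simp)
  also have "\<dots> \<le> card (?V \<times> ?Y)" using finV finY by (intro card_image_le) simp
  finally show "card (?cls ` {z \<in> lang. length z = N}) \<le> card (?V \<times> ?Y)" .
qed

section \<open>Loops at a vertex and free pairs\<close>

lemma loop_exists:
  assumes "replicate n0 a @ z \<in> lang"
  obtains N where "N > 0"
    "\<And>M. N dvd M \<Longrightarrow> n0 + length z \<le> M \<Longrightarrow>
      \<exists>y. replicate n0 a @ z @ y @ replicate n0 a \<in> lang \<and> length (z @ y @ replicate n0 a) = M"
proof -
  let ?e = "replicate n0 a"
  let ?k = "n0 + length z"
  obtain w where w: "w \<in> lists (alphabet A)" "?e @ z = res (replicate ?k a) w"
    using lang_eq[OF assms] by auto
  \<comment> \<open>If the power \<open>M\<close> of \<open>a\<close> fixes \<open>w\<close>, its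
    square has residual \<open>?D @ ?D\<close> at \<open>w\<close>, where \<open>?D\<close> begins
    with \<open>?e @ z\<close>. Reading up to the second occurrence of \<open>?e\<close> closes the
    path to a loop of length \<open>M\<close>.\<close>
  obtain N where N: "N > 0" "act (replicate N a) w = w"
    using word_action_finite_order[OF inv, of "[a]" "length w"] a_state w(1)
    by (auto simp: concat_replicate_single)
  have "\<exists>y. ?e @ z @ y @ ?e \<in> lang \<and> length (z @ y @ ?e) = M" if M: "N dvd M" "?k \<le> M" for M
  proof -
    obtain j where j: "M = N * j" using M(1) by (elim dvdE)
    have "(act (replicate N a) ^^ j) w = w" using N(2) by (induction j) auto
    then have fixw: "act (replicate M a) w = w"
      by (simp only: j concat_replicate_replicate[symmetric] word_action_concat_replicate)
    let ?D = "res (replicate M a) w"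
    define y where "y = res (replicate (M - ?k) a) (act (replicate ?k a) w)"
    have "replicate M a = replicate ?k a @ replicate (M - ?k) a"
      using M(2) by (simp add: replicate_add[symmetric])
    then have D: "?D = ?e @ z @ y"
      by (simp only: residual_append y_def w(2)[symmetric]) simp
    have len: "length (?e @ z @ y) = M" using D length_word_action length_replicate by metis
    have "res (replicate (M + M) a) w = ?D @ ?D"
      by (simp only: replicate_add residual_append fixw)
    then have "?D @ ?D \<in> lang" using lang_res[OF lang_replicate w(1)] by metis
    then have "(?e @ z @ y @ ?e) @ (z @ y) \<in> lang" by (simp add: D)
    from lang_prefix[OF this] show ?thesis using len by (intro exI[of _ y]) auto
  qed
  then show thesis using that N(1) by blast
qed

text \<open>Every loop ends at the vertex where the next one starts, so splicing applies; the second
  conclusion keeps this final vertex available to the induction.\<close>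

lemma loops_in_lang:
  assumes "\<And>u. u \<in> S \<Longrightarrow> \<exists>u'. u = u' @ replicate n0 a \<and> replicate n0 a @ u \<in> lang"
    and "W \<in> lists S"
  shows "replicate n0 a @ concat W \<in> lang \<and> (\<exists>p. replicate n0 a @ concat W = p @ replicate n0 a)"
  using assms(2)
proof (induction W)
  case Nil
  then show ?case using lang_replicate by auto
next
  case (Cons u W)
  let ?e = "replicate n0 a"
  obtain u' where u: "u = u' @ ?e" "?e @ u \<in> lang" using assms(1) Cons.hyps by blast
  obtain p where p: "?e @ concat W = p @ ?e" and l: "?e @ concat W \<in> lang"
    using Cons.IH by blast
  have "(?e @ u') @ ?e @ concat W \<in> lang"
    by (rule lang_splice) (use u l in simp_all)
  moreover have "?e @ concat (u # W) = (?e @ u' @ p) @ ?e" using u(1) p by simp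
  ultimately show ?case using u(1) by auto
qed

text \<open>Some letter \<open>x\<close> may leave the base vertex without starting any path equal,
  with the same end points, to the reference path of maximal \<open>num_first\<close>. A loop
  \<open>u\<close> prolonging that path and a loop \<open>v\<close> starting with \<open>x\<close>
  then never begin equal products of equally many factors.\<close>

lemma free_pair:
  assumes n1: "n1 > 0" "\<And>n. n > 0 \<Longrightarrow> num_first n \<le> num_first n1"
    and less: "num_first n1 < card (ext (replicate n0 a))"
  shows "\<exists>u\<in>lists (states A). \<exists>v\<in>lists (states A). u \<noteq> v \<and>
    (\<forall>U\<in>lists {u, v}. \<forall>V\<in>lists {u, v}. length U = length V \<longrightarrow> concat U \<approx> concat V \<longrightarrow> U = V)"
proof -
  let ?e = "replicate n0 a"
  let ?z = "replicate n1 a"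
  have zl: "?e @ ?z \<in> lang" using lang_replicate[of "n0 + n1"] by (simp add: replicate_add)
  have zne: "?z \<noteq> []" using n1(1) by simp
  have "\<exists>x. x \<in> ext ?e \<and> x \<notin> first_letters ?e ?z"
  proof (rule ccontr)
    assume "\<not> ?thesis"
    then have "ext ?e \<subseteq> first_letters ?e ?z" by blast
    moreover have "finite (first_letters ?e ?z)"
      using finite_subset[OF first_letters_ext[OF zne] finite_ext] .
    ultimately show False using less card_mono unfolding num_first_def by (metis not_less)
  qed
  then obtain x where x: "?e @ [x] \<in> lang" "x \<notin> first_letters ?e ?z"
    by (auto simp: ext_def)
  obtain t where t: "length t = n1 - 1" "(?e @ [x]) @ t \<in> lang"
    using lang_extend_right[OF x(1)] .
  let ?z' = "x # t"
  have z'l: "?e @ ?z' \<in> lang" and z'len: "length ?z' = n1" using t n1(1) by simp_all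
  obtain N N' where N: "N > 0" "\<And>M. N dvd M \<Longrightarrow> n0 + n1 \<le> M \<Longrightarrow>
      \<exists>y. ?e @ ?z @ y @ ?e \<in> lang \<and> length (?z @ y @ ?e) = M"
    and N': "N' > 0" "\<And>M. N' dvd M \<Longrightarrow> n0 + n1 \<le> M \<Longrightarrow>
      \<exists>y. ?e @ ?z' @ y @ ?e \<in> lang \<and> length (?z' @ y @ ?e) = M"
    using loop_exists[OF zl] loop_exists[OF z'l] z'len by (metis length_replicate)
  \<comment> \<open>A common multiple of both periods that is at least \<open>n0 + n1\<close> gives
    the two loops the same length.\<close>
  define M where "M = N * N' * (n0 + n1)"
  have M: "N dvd M" "N' dvd M" "n0 + n1 \<le> M"
    using N(1) N'(1) by (auto simp: M_def)
  obtain y where y: "?e @ ?z @ y @ ?e \<in> lang" "length (?z @ y @ ?e) = M"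
    using N(2)[OF M(1,3)] by blast
  obtain y' where y': "?e @ ?z' @ y' @ ?e \<in> lang" "length (?z' @ y' @ ?e) = M"
    using N'(2)[OF M(2,3)] by blast
  define u where "u = ?z @ y @ ?e"
  define v where "v = ?z' @ y' @ ?e"
  have us: "u \<in> lists (states A)" "v \<in> lists (states A)"
    using y(1) y'(1) lang_states unfolding u_def v_def by auto
  have len: "length u = M" "length v = M" using y y' by (simp_all add: u_def v_def)
  have loops: "\<exists>s'. s = s' @ ?e \<and> ?e @ s \<in> lang" if "s \<in> {u, v}" for s
  proof -
    have "u = (?z @ y) @ ?e" "v = (?z' @ y') @ ?e" by (simp_all add: u_def v_def)
    moreover have "?e @ u \<in> lang" "?e @ v \<in> lang" using y(1) y'(1) by (simp_all add: u_def v_def)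
    ultimately show ?thesis using that by (metis insert_iff singletonD)
  qed
  have lenW: "length (concat W) = length W * M" if "W \<in> lists {u, v}" for W
    using that len by (induction W) auto
  have no: "\<not> concat (u # U) \<approx> concat (v # V)"
    if UV: "U \<in> lists {u, v}" "V \<in> lists {u, v}" "length U = length V" for U V
  proof
    assume eq: "concat (u # U) \<approx> concat (v # V)"
    let ?W = "concat (u # U)" and ?W' = "concat (v # V)"
    obtain p where p: "?e @ ?W = p @ ?e" and l: "?e @ ?W \<in> lang"
      using loops_in_lang[of "{u, v}" "u # U"] loops UV by auto
    obtain p' where p': "?e @ ?W' = p' @ ?e" and l': "?e @ ?W' \<in> lang"
      using loops_in_lang[of "{u, v}" "v # V"] loops UV by auto
    have lw: "length ?W' = length ?W" using lenW UV len by simp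
    have "length p = length ?W" "length p' = length ?W"
      using arg_cong[OF p, of length] arg_cong[OF p', of length] lw by simp_all
    then have "drop (length ?W) (?e @ ?W') = drop (length ?W) (?e @ ?W)"
      unfolding p p' by simp
    moreover have "hd ?W' = x" by (simp add: v_def)
    ultimately have "x \<in> first_letters ?e ?W"
      unfolding first_letters_def using lw l' word_equiv_sym[OF eq] by blast
    \<comment> \<open>Prolonging \<open>?z\<close> can only enlarge the set, and \<open>n1\<close>
      is maximal, so the set does not change; but \<open>x\<close> lies outside it.\<close>
    moreover have "first_letters ?e ?W = first_letters ?e ?z"
    proof -
      have W: "?W = ?z @ (y @ ?e @ concat U)" by (simp add: u_def)
      have ne: "?W \<noteq> []" using W zne by simp
      have sub: "first_letters ?e ?z \<subseteq> first_letters ?e ?W"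
        unfolding W by (rule first_letters_mono) (use l W zne in simp_all)
      have "card (first_letters ?e ?W) \<le> card (first_letters ?e ?z)"
        using card_first_letters[OF l _ ne] card_first_letters[OF zl _ zne] n1(2)[of "length ?W"] ne
        by simp
      then show ?thesis
        using card_seteq[OF finite_subset[OF first_letters_ext[OF ne] finite_ext] sub] by simp
    qed
    ultimately show False using x(2) by simp
  qed
  \<comment> \<open>Common leading loops are cancelled until the first disagreement, which
    \<open>no\<close> excludes.\<close>
  have free: "U = V"
    if "U \<in> lists {u, v}" "V \<in> lists {u, v}" "length U = length V" "concat U \<approx> concat V" for U V
    using that(3,1,2,4)
  proof (induction U V rule: list_induct2)
    case (Cons s U r V)
    have sr: "s \<in> {u, v}" "r \<in> {u, v}" "U \<in> lists {u, v}" "V \<in> lists {u, v}"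
      using Cons.prems by auto
    have "\<not> (s = u \<and> r = v)"
      using no[OF sr(3,4) Cons.hyps] Cons.prems(3) by blast
    moreover have "\<not> (s = v \<and> r = u)"
      using no[OF sr(4,3) Cons.hyps[symmetric]] word_equiv_sym[OF Cons.prems(3)] by blast
    ultimately have "s = r" using sr(1,2) by blast
    moreover have "s \<in> lists (states A)" using sr(1) us by auto
    ultimately have "concat U \<approx> concat V"
      using word_equiv_cancel_left[OF inv, of s "concat U" "concat V"] Cons.prems(3) by simp
    then show ?case using Cons.IH sr \<open>s = r\<close> by simp
  qed simp
  have "u \<noteq> v" using no[of "[]" "[]"] by auto
  then show ?thesis using us free by blast
qed

end

text \<open>A relation \<open>U = V\<close> gives the relations \<open>U s V = V s U\<close> between words of equal length.\<close>

lemma free_of_equal_lengths: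
  assumes mealy: "mealy_automaton A"
    and u: "u \<in> lists (states A)" "v \<in> lists (states A)" "u \<noteq> v"
    and free: "\<And>U V. U \<in> lists {u, v} \<Longrightarrow> V \<in> lists {u, v} \<Longrightarrow> length U = length V \<Longrightarrow>
      word_equiv A (concat U) (concat V) \<Longrightarrow> U = V"
    and UV: "U \<in> lists {u, v}" "V \<in> lists {u, v}" "word_equiv A (concat U) (concat V)"
  shows "U = V"
proof -
  have cs: "concat W \<in> lists (states A)" if "W \<in> lists {u, v}" for W
    using that u(1,2) by (induction W) auto
  have comm: "U @ [s] @ V = V @ [s] @ U" if s: "s \<in> {u, v}" for s
  proof (rule free)
    have sV: "s \<in> lists (states A)" using s u by auto
    have "word_equiv A (s @ concat V) (s @ concat U)"
      using word_equiv_append[OF mealy sV word_equiv_refl word_equiv_sym[OF UV(3)]] .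
    then have "word_equiv A (concat U @ (s @ concat V)) (concat V @ (s @ concat U))"
      by (rule word_equiv_append[OF mealy cs[OF UV(1)] UV(3)])
    then show "word_equiv A (concat (U @ [s] @ V)) (concat (V @ [s] @ U))" by simp
  qed (use UV s in auto)
  \<comment> \<open>If \<open>U\<close> were shorter than \<open>V\<close>, the relation for
    \<open>s\<close> would put \<open>s\<close> at position \<open>length U\<close> of
    \<open>V\<close>, for \<open>s = u\<close> and \<open>s = v\<close> alike.\<close>
  have *: "length U \<noteq> n" if "length U < length V \<and> n = length U" for n
  proof -
    have "(V @ [s] @ U) ! length U = s" if "s \<in> {u, v}" for s
      using comm[OF that] by (metis append_Cons nth_append_length)
    then have "V ! length U = u" "V ! length U = v" using that by (auto simp: nth_append)
    then show ?thesis using u(3) by simp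
  qed
  have **: "\<not> length V < length U"
  proof
    assume "length V < length U"
    moreover have "(U @ [s] @ V) ! length V = s" if "s \<in> {u, v}" for s
      using comm[OF that] by (metis append_Cons nth_append_length)
    ultimately have "U ! length V = u" "U ! length V = v" by (auto simp: nth_append)
    then show False using u(3) by simp
  qed
  have "length U = length V" using * ** by fastforce
  then show ?thesis using free UV by blast
qed

text \<open>Either the maximal value of \<open>num_first\<close> reaches the number of allowed
  letters and \<open>a\<close> is torsion, which is excluded, or it stays below and a free pair
  exists.\<close>

theorem torsion_or_free:
  assumes inv: "invertible_automaton A" and rev: "invertible_automaton (dual_automaton A)"
    and a: "a \<in> states A"
    and inf: "\<And>N. N > 0 \<Longrightarrow> \<not> word_equiv A (replicate N a) []"
  shows "\<exists>u\<in>lists (states A). \<exists>v\<in>lists (states A). u \<noteq> v \<and>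
    (\<forall>U\<in>lists {u, v}. \<forall>V\<in>lists {u, v}. word_equiv A (concat U) (concat V) \<longrightarrow> U = V)"
proof -
  interpret reversible_state A a by unfold_locales (fact inv rev a)+
  obtain n0 where "\<And>u v. u @ v \<in> lang \<Longrightarrow> length v = n0 \<Longrightarrow> ext (u @ v) = ext v"
    using ext_stabilises by blast
  then interpret stable_state A a n0 by unfold_locales
  obtain n1 where n1: "n1 > 0" "\<And>n. n > 0 \<Longrightarrow> num_first n \<le> num_first n1"
    using num_first_max by blast
  have "num_first n1 \<noteq> card (ext (replicate n0 a))"
    using collapse_torsion[OF n1(1)] inf by blast
  then have "num_first n1 < card (ext (replicate n0 a))"
    using num_first_le[OF n1(1)] by simp
  from free_pair[OF n1 this] obtain u v where
    uv: "u \<in> lists (states A)" "v \<in> lists (states A)" "u \<noteq> v"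
    and free: "\<And>U V. U \<in> lists {u, v} \<Longrightarrow> V \<in> lists {u, v} \<Longrightarrow> length U = length V \<Longrightarrow>
      word_equiv A (concat U) (concat V) \<Longrightarrow> U = V"
    by blast
  have "\<forall>U\<in>lists {u, v}. \<forall>V\<in>lists {u, v}. word_equiv A (concat U) (concat V) \<longrightarrow> U = V"
    using free_of_equal_lengths[OF invertible_mealy[OF inv] uv free] by blast
  then show ?thesis using uv by blast
qed

section \<open>Automata of words and of signed states\<close>

text \<open>Makes a word of length \<open>k\<close> a single state, so that results on the powers of
  one state apply to the powers of a word.\<close>

definition power_automaton :: "('q, 'l) mealy \<Rightarrow> nat \<Rightarrow> ('q list, 'l) mealy" where
  "power_automaton A k = \<lparr>states = {u \<in> lists (states A). length u = k}, alphabet = alphabet A,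
     out_letter = (\<lambda>u l. fold (out_letter A) u l),
     next_state = (\<lambda>u l. action (dual_automaton A) l u)\<rparr>"

lemma power_simps [simp]:
  "states (power_automaton A k) = {u \<in> lists (states A). length u = k}"
  "alphabet (power_automaton A k) = alphabet A"
  "out_letter (power_automaton A k) u l = fold (out_letter A) u l"
  "next_state (power_automaton A k) u l = action (dual_automaton A) l u"
  by (simp_all add: power_automaton_def)

lemma action_power: "action (power_automaton A k) u w = word_action A u w"
  by (induction w arbitrary: u) (auto simp: word_action_Cons2)

lemma word_action_power: "word_action (power_automaton A k) us w = word_action A (concat us) w"
  by (induction us arbitrary: w) (auto simp: word_action_Cons word_action_append action_power)

lemma bij_fold_out:
  assumes "invertible_automaton A" "u \<in> lists (states A)"
  shows "bij_betw (fold (out_letter A) u) (alphabet A) (alphabet A)"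
proof -
  have fin: "finite (alphabet A)"
    using assms(1) by (simp add: invertible_automaton_def mealy_automaton_def)
  have "fold (out_letter A) u l \<in> alphabet A" if "l \<in> alphabet A" for l
    using word_action_in_lists[OF invertible_mealy[OF assms(1)] assms(2), of "[l]"] that
    by (simp add: word_action_single)
  moreover have "inj_on (fold (out_letter A) u) (alphabet A)"
  proof (rule inj_onI)
    fix l l' assume l: "l \<in> alphabet A" "l' \<in> alphabet A"
      and "fold (out_letter A) u l = fold (out_letter A) u l'"
    then have "word_action A u [l] = word_action A u [l']" by (simp add: word_action_single)
    moreover have "[l] \<in> lists (alphabet A)" "[l'] \<in> lists (alphabet A)" using l by simp_all
    ultimately have "[l] = [l']"
      using bij_betw_imp_inj_on[OF bij_word_action[OF assms]] inj_onD by metis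
    then show "l = l'" by simp
  qed
  ultimately show ?thesis
    using endo_inj_surj[OF fin] by (simp add: bij_betw_def image_subset_iff)
qed

lemma power_invertible:
  assumes "invertible_automaton A" "invertible_automaton (dual_automaton A)"
  shows "invertible_automaton (power_automaton A k)"
    and "invertible_automaton (dual_automaton (power_automaton A k))"
proof -
  let ?S = "{u \<in> lists (states A). length u = k}"
  have fin: "finite (states A)" "finite (alphabet A)"
    using assms(1) by (simp_all add: invertible_automaton_def mealy_automaton_def)
  have finS: "finite ?S"
    using finite_lists_length_eq[OF fin(1), of k] by (simp add: lists_eq_set)
  have bij: "bij_betw (action (dual_automaton A) l) ?S ?S" if l: "l \<in> alphabet A" for l
  proof -
    have b: "bij_betw (action (dual_automaton A) l) (lists (states A)) (lists (states A))"
      using bij_betw_action[OF assms(2)] l by simp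
    have "inj_on (action (dual_automaton A) l) ?S"
      by (rule inj_on_subset[OF bij_betw_imp_inj_on[OF b]]) auto
    moreover have "action (dual_automaton A) l ` ?S \<subseteq> ?S"
      using bij_betw_imp_surj_on[OF b] by fastforce
    ultimately show ?thesis using endo_inj_surj[OF finS] by (simp add: bij_betw_def)
  qed
  have mealy: "mealy_automaton (power_automaton A k)"
    unfolding mealy_automaton_def power_simps
  proof (intro conjI ballI finS fin(2))
    fix u l assume u: "u \<in> ?S" and l: "l \<in> alphabet A"
    show "fold (out_letter A) u l \<in> alphabet A"
      using bij_fold_out[OF assms(1)] u l bij_betw_apply by fastforce
    show "action (dual_automaton A) l u \<in> ?S"
      using bij[OF l] u bij_betw_apply by fastforce
  qed
  then show "invertible_automaton (power_automaton A k)"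
    unfolding invertible_automaton_def power_simps using bij_fold_out[OF assms(1)] by blast
  show "invertible_automaton (dual_automaton (power_automaton A k))"
    unfolding invertible_automaton_def using bij dual_mealy[OF mealy]
    by (simp add: dual_automaton_def)
qed

text \<open>The disjoint union of the automaton and its inverse, with \<open>(q, False)\<close> as
  the formal inverse of \<open>q\<close>. The signs match those of \<open>gword\<close>, so words of
  states are words in group generators.\<close>

definition sym_automaton :: "('q, 'l) mealy \<Rightarrow> ('q \<times> bool, 'l) mealy" where
  "sym_automaton A = \<lparr>states = states A \<times> UNIV, alphabet = alphabet A,
     out_letter = (\<lambda>(q, b) l. if b then out_letter A q l else inv_into (alphabet A) (out_letter A q) l),
     next_state = (\<lambda>(q, b) l.
       (next_state A q (if b then l else inv_into (alphabet A) (out_letter A q) l), b))\<rparr>"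

lemma sym_simps [simp]:
  "states (sym_automaton A) = states A \<times> UNIV"
  "alphabet (sym_automaton A) = alphabet A"
  "out_letter (sym_automaton A) (q, True) l = out_letter A q l"
  "out_letter (sym_automaton A) (q, False) l = inv_into (alphabet A) (out_letter A q) l"
  "next_state (sym_automaton A) (q, True) l = (next_state A q l, True)"
  "next_state (sym_automaton A) (q, False) l =
     (next_state A q (inv_into (alphabet A) (out_letter A q) l), False)"
  by (simp_all add: sym_automaton_def)

lemma inv_out_letter:
  assumes "invertible_automaton A" "q \<in> states A" "l \<in> alphabet A"
  shows "inv_into (alphabet A) (out_letter A q) l \<in> alphabet A"
    and "out_letter A q (inv_into (alphabet A) (out_letter A q) l) = l"
    and "inv_into (alphabet A) (out_letter A q) (out_letter A q l) = l"
  using assms by (auto simp: invertible_automaton_def bij_betw_def inv_into_into f_inv_into_f)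

lemma sym_invertible:
  assumes "invertible_automaton A"
  shows "invertible_automaton (sym_automaton A)"
proof -
  have m: "mealy_automaton A" using invertible_mealy[OF assms] .
  have b: "bij_betw (out_letter A q) (alphabet A) (alphabet A)" if "q \<in> states A" for q
    using assms that by (simp add: invertible_automaton_def)
  have "mealy_automaton (sym_automaton A)"
    unfolding mealy_automaton_def
  proof (intro conjI ballI)
    fix p l assume pl: "p \<in> states (sym_automaton A)" "l \<in> alphabet (sym_automaton A)"
    obtain q c where p: "p = (q, c)" by fastforce
    show "out_letter (sym_automaton A) p l \<in> alphabet (sym_automaton A)"
      "next_state (sym_automaton A) p l \<in> states (sym_automaton A)"
      using pl p m inv_out_letter(1)[OF assms] by (cases c; auto simp: mealy_automaton_def)+
  qed (use m in \<open>auto simp: mealy_automaton_def\<close>)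
  moreover have "bij_betw (out_letter (sym_automaton A) p) (alphabet A) (alphabet A)"
    if "p \<in> states A \<times> UNIV" for p
  proof -
    obtain q c where p: "p = (q, c)" by fastforce
    then show ?thesis
      using that b[of q] bij_betw_inv_into[OF b[of q]] by (cases c) (auto simp: sym_automaton_def)
  qed
  ultimately show ?thesis by (simp add: invertible_automaton_def)
qed

text \<open>On negative states the transitions are those of \<open>inverse_automaton A\<close>,
  whose reversibility comes from bireversibility.\<close>

lemma sym_reversible:
  assumes "bireversible_automaton A"
  shows "invertible_automaton (dual_automaton (sym_automaton A))"
proof -
  have inv: "invertible_automaton A" and rev: "reversible_automaton A"
    using assms by (simp_all add: bireversible_automaton_def)
  have m: "mealy_automaton (sym_automaton A)"
    using invertible_mealy[OF sym_invertible[OF inv]] .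
  have "bij_betw (\<lambda>p. next_state (sym_automaton A) p l) (states A \<times> UNIV) (states A \<times> UNIV)"
    if l: "l \<in> alphabet A" for l
  proof -
    have 1: "bij_betw (\<lambda>q. next_state A q l) (states A) (states A)"
      using rev l by (simp add: reversible_automaton_def)
    have 2: "bij_betw (\<lambda>p. next_state (inverse_automaton A) p l) (Inv ` states A) (Inv ` states A)"
      using inverse_reversible[OF assms] l
      by (simp add: reversible_automaton_def inverse_automaton_def)
    have "inj_on (\<lambda>p. next_state (sym_automaton A) p l) (states A \<times> UNIV)"
    proof (rule inj_onI)
      fix p p' assume p: "p \<in> states A \<times> UNIV" "p' \<in> states A \<times> UNIV"
        and eq: "next_state (sym_automaton A) p l = next_state (sym_automaton A) p' l"
      obtain q c q' c' where q: "p = (q, c)" "p' = (q', c')" by fastforce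
      have c: "c = c'" using eq q by (cases c; cases c') auto
      show "p = p'"
      proof (cases c)
        case True
        then have "next_state A q l = next_state A q' l" using eq q c by simp
        then show ?thesis using inj_onD[OF bij_betw_imp_inj_on[OF 1]] p q c by auto
      next
        case False
        then have "next_state (inverse_automaton A) (Inv q) l = next_state (inverse_automaton A) (Inv q') l"
          using eq q c by (simp add: inverse_automaton_def)
        then have "Inv q = Inv q'" using inj_onD[OF bij_betw_imp_inj_on[OF 2]] p q by auto
        then show ?thesis using q c by simp
      qed
    qed
    moreover have "(\<lambda>p. next_state (sym_automaton A) p l) ` (states A \<times> UNIV) \<subseteq> states A \<times> UNIV"
      using m l unfolding mealy_automaton_def sym_simps(1,2) by blast
    moreover have "finite (states A \<times> (UNIV :: bool set))"
      using invertible_mealy[OF inv] by (simp add: mealy_automaton_def)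
    ultimately show ?thesis by (metis bij_betw_def endo_inj_surj)
  qed
  then show ?thesis using dual_mealy[OF m] by (simp add: invertible_automaton_def)
qed

lemma action_sym_True: "action (sym_automaton A) (q, True) w = action A q w"
  by (induction w arbitrary: q) auto

lemma action_sym_False:
  assumes "invertible_automaton A" "q \<in> states A" "w \<in> lists (alphabet A)"
  shows "action A q (action (sym_automaton A) (q, False) w) = w"
    and "action (sym_automaton A) (q, False) (action A q w) = w"
proof -
  have m: "mealy_automaton A" using invertible_mealy[OF assms(1)] .
  have "action A q (action (sym_automaton A) (q, False) w) = w \<and>
    action (sym_automaton A) (q, False) (action A q w) = w"
    using assms(2,3)
  proof (induction w arbitrary: q)
    case (Cons l w)
    have l: "l \<in> alphabet A" using Cons.prems by simp
    note inv = inv_out_letter[OF assms(1) Cons.prems(1) l]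
    have "next_state A q l \<in> states A"
      "next_state A q (inv_into (alphabet A) (out_letter A q) l) \<in> states A"
      using m l Cons.prems inv(1) by (auto simp: mealy_automaton_def)
    then show ?case using inv Cons.IH Cons.prems(2) by simp
  qed simp
  then show "action A q (action (sym_automaton A) (q, False) w) = w"
    "action (sym_automaton A) (q, False) (action A q w) = w" by simp_all
qed

section \<open>Orders of the words acting on words\<close>

lemma concat_replicate_mult:
  "concat (replicate m (concat (replicate n u))) = concat (replicate (n * m) u)"
  by (induction m) (simp_all add: replicate_add)

text \<open>If \<open>v\<close> fixes \<open>w\<close>, the residual at \<open>w\<close> of a power
  of \<open>v\<close> is the same power of the residual. So once a power of \<open>u\<close> fixes
  \<open>w\<close>, its \<open>n\<close>th power fixes the next letter too. Orbit lengths therefore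
  divide powers of \<open>n\<close>.\<close>

lemma word_action_order_power:
  assumes "invertible_automaton A" "u \<in> lists (states A)" "w \<in> lists (alphabet A)"
    and n: "\<And>v l. v \<in> lists (states A) \<Longrightarrow> l \<in> alphabet A \<Longrightarrow>
      word_action A (concat (replicate n v)) [l] = [l]"
    and rev: "mealy_automaton (dual_automaton A)"
  shows "word_action A (concat (replicate (n ^ length w) u)) w = w"
  using assms(3)
proof (induction w rule: rev_induct)
  case (snoc l w)
  have w: "w \<in> lists (alphabet A)" and l: "l \<in> alphabet A" using snoc.prems by auto
  define v where "v = concat (replicate (n ^ length w) u)"
  have v: "v \<in> lists (states A)" using assms(2) by (auto simp: v_def in_lists_conv_set)
  have fix_v: "word_action A v w = w" using snoc.IH w by (simp add: v_def)
  let ?r = "word_action (dual_automaton A) w"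
  have res: "?r (concat (replicate k v)) = concat (replicate k (?r v))" for k
    by (induction k) (simp_all add: residual_append fix_v)
  have "(word_action A v ^^ k) w = w" for k using fix_v by (induction k) auto
  then have "word_action A (concat (replicate n v)) w = w"
    by (simp add: word_action_concat_replicate)
  moreover have "?r v \<in> lists (states A)"
    using word_action_in_lists[OF rev, of w v] w v by simp
  then have "word_action A (concat (replicate n (?r v))) [l] = [l]" using n l by blast
  ultimately have "word_action A (concat (replicate n v)) (w @ [l]) = w @ [l]"
    by (simp only: word_action_append2 res)
  then show ?case by (simp add: v_def concat_replicate_mult mult.commute)
qed simp

lemma funpow_coprime_fixed:
  assumes "(f ^^ p) x = x" "(f ^^ k) x = x" "coprime p k" "p \<noteq> 0"
  shows "f x = x"
proof -
  obtain i j where ij: "p * i = k * j + 1"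
    using bezout_nat[OF assms(4), of k] assms(3) by (auto simp: coprime_iff_gcd_eq_1)
  have mult: "(f ^^ (n * m)) x = x" if "(f ^^ n) x = x" for n m
    using that by (induction m) (auto simp: funpow_add)
  have "f ((f ^^ (k * j)) x) = x" using mult[OF assms(1), of i] ij by simp
  then show ?thesis using mult[OF assms(2)] by simp
qed

text \<open>Makes the operations of a generated permutation group explicit, for use with both
  \<open>perm_group\<close> and \<open>automaton_group\<close>.\<close>

lemma subgroup_of_BijGroup:
  fixes X :: "'a set" and T :: "('a \<Rightarrow> 'a) set"
  defines "P \<equiv> subgroup_generated (BijGroup X) T"
  shows "group P"
    and "T \<subseteq> carrier (BijGroup X) \<Longrightarrow> T \<subseteq> carrier P"
    and "\<And>f. f \<in> carrier P \<Longrightarrow> f \<in> Bij X"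
    and "\<And>f g. f \<in> carrier P \<Longrightarrow> g \<in> carrier P \<Longrightarrow> f \<otimes>\<^bsub>P\<^esub> g = compose X f g"
    and "\<one>\<^bsub>P\<^esub> = (\<lambda>x\<in>X. x)"
    and "\<And>f. f \<in> carrier P \<Longrightarrow> inv\<^bsub>P\<^esub> f = restrict (inv_into X f) X"
proof -
  interpret G: group "BijGroup X" by (rule group_BijGroup)
  show "group P" unfolding P_def by simp
  show "T \<subseteq> carrier P" if "T \<subseteq> carrier (BijGroup X)"
    using that by (auto simp: P_def carrier_subgroup_generated intro: generate.incl)
  have sub: "carrier P \<subseteq> carrier (BijGroup X)"
    unfolding P_def by (rule G.carrier_subgroup_generated_subset)
  then show B: "f \<in> Bij X" if "f \<in> carrier P" for f
    using that by (auto simp: BijGroup_def)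
  show "f \<otimes>\<^bsub>P\<^esub> g = compose X f g" if "f \<in> carrier P" "g \<in> carrier P" for f g
    using B[OF that(1)] B[OF that(2)] by (simp add: P_def subgroup_generated_def BijGroup_def)
  show "\<one>\<^bsub>P\<^esub> = (\<lambda>x\<in>X. x)"
    by (simp add: P_def subgroup_generated_def BijGroup_def)
  show "inv\<^bsub>P\<^esub> f = restrict (inv_into X f) X" if f: "f \<in> carrier P" for f
    using f inv_BijGroup[OF B[OF f]] by (simp add: P_def)
qed

lemma restrict_inv_into: "x \<in> X \<Longrightarrow> inv_into X (restrict f X) x = inv_into X f x"
  unfolding inv_into_def by (metis (mono_tags, lifting) restrict_apply')

text \<open>The dual of a signed automaton acts separately on the letters of each sign; the map \<open>h\<close>
  stands for the inclusion of the letters of one sign.\<close>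

lemma local_order:
  assumes A: "invertible_automaton A" and C: "invertible_automaton C" "states C = states A"
    and h: "\<And>x. x \<in> alphabet A \<Longrightarrow> h x \<in> alphabet C"
      "\<And>s x. s \<in> states A \<Longrightarrow> x \<in> alphabet A \<Longrightarrow> out_letter C s (h x) = h (out_letter A s x)"
    and u: "u \<in> lists (states (sym_automaton C))" and x: "x \<in> alphabet A"
  shows "word_action (sym_automaton C) (concat (replicate (perm_order A) u)) [h x] = [h x]"
proof -
  let ?G = "perm_group A" and ?X = "alphabet A"
  note P = subgroup_of_BijGroup[where X = ?X and T = "(\<lambda>q. restrict (out_letter A q) ?X) ` states A",
    folded perm_group_def]
  have gen: "restrict (out_letter A s) ?X \<in> carrier ?G" if "s \<in> states A" for s
    using P(2) output_in_BijGroup[OF A] that by blast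
  interpret G: group ?G by (rule P(1))
  \<comment> \<open>The word acts on the image of \<open>h\<close> through an element
    \<open>f\<close> of \<open>perm_group A\<close>, and raising \<open>f\<close> to the group order
    gives the identity.\<close>
  have "\<exists>f\<in>carrier ?G. \<forall>x\<in>?X. word_action (sym_automaton C) u [h x] = [h (f x)]"
    using u
  proof (induction u)
    case Nil
    have "\<forall>x\<in>?X. word_action (sym_automaton C) [] [h x] = [h (\<one>\<^bsub>?G\<^esub> x)]"
      by (simp add: P(5))
    then show ?case using G.one_closed by blast
  next
    case (Cons p u)
    obtain s c where p: "p = (s, c)" by fastforce
    have s: "s \<in> states A" using Cons.hyps p C(2) by auto
    obtain f where f: "f \<in> carrier ?G"
      "\<And>x. x \<in> ?X \<Longrightarrow> word_action (sym_automaton C) u [h x] = [h (f x)]"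
      using Cons.IH by blast
    let ?g = "restrict (out_letter A s) ?X"
    define g where "g = (if c then ?g else inv\<^bsub>?G\<^esub> ?g)"
    have g: "g \<in> carrier ?G" using gen[OF s] by (simp add: g_def)
    have gX: "g x \<in> ?X" if "x \<in> ?X" for x
      using P(3)[OF g] that Bij_imp_funcset by auto
    have out: "out_letter (sym_automaton C) p (h x) = h (g x)" if x: "x \<in> ?X" for x
    proof (cases c)
      case True
      then show ?thesis using h(2)[OF s x] x p by (simp add: g_def)
    next
      case False
      define y where "y = inv_into ?X (out_letter A s) x"
      have y: "y \<in> ?X" "out_letter A s y = x"
        using inv_out_letter[OF A s x] by (simp_all add: y_def)
      have "out_letter C s (h y) = h x" using h(2)[OF s y(1)] y(2) by simp
      then have "inv_into (alphabet C) (out_letter C s) (h x) = h y"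
        using inv_out_letter(3)[OF C(1), of s "h y"] s C(2) h(1)[OF y(1)] by simp
      moreover have "g x = y" using False x P(6)[OF gen[OF s]] by (simp add: g_def y_def restrict_inv_into)
      ultimately show ?thesis using p False by simp
    qed
    have "f \<otimes>\<^bsub>?G\<^esub> g \<in> carrier ?G" using f g by simp
    moreover have "word_action (sym_automaton C) (p # u) [h x] = [h ((f \<otimes>\<^bsub>?G\<^esub> g) x)]" if "x \<in> ?X" for x
      using that out f(2)[OF gX] P(4)[OF f(1) g] by (simp add: word_action_Cons compose_def)
    ultimately show ?case by blast
  qed
  then obtain f where f: "f \<in> carrier ?G"
    "\<And>x. x \<in> ?X \<Longrightarrow> word_action (sym_automaton C) u [h x] = [h (f x)]" by blast
  have fX: "f x \<in> ?X" if "x \<in> ?X" for x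
    using P(3)[OF f(1)] that Bij_imp_funcset by auto
  have "word_action (sym_automaton C) (concat (replicate n u)) [h x] = [h ((f [^]\<^bsub>?G\<^esub> n) x)]"
    if "x \<in> ?X" for n x
    using that
  proof (induction n arbitrary: x)
    case 0
    then show ?case by (simp add: P(5))
  next
    case (Suc n)
    then show ?case
      using f fX P(4)[of "f [^]\<^bsub>?G\<^esub> n" f] by (simp add: word_action_append compose_def)
  qed
  from this[OF x, of "perm_order A"] show ?thesis
    using x G.pow_order_eq_1[OF f(1)] by (simp add: perm_order_def P(5))
qed

section \<open>Elements of infinite order\<close>

text \<open>The value of a signed word under the homomorphism from the free group that is given by
  \<open>f\<close>.\<close>

definition eval_word :: "('h, 'm) monoid_scheme \<Rightarrow> ('x \<Rightarrow> 'h) \<Rightarrow> ('x \<times> bool) list \<Rightarrow> 'h" where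
  "eval_word H f u = foldr (\<lambda>(x, b) y. (if b then f x else inv\<^bsub>H\<^esub> (f x)) \<otimes>\<^bsub>H\<^esub> y) u \<one>\<^bsub>H\<^esub>"

lemma eval_word_simps [simp]:
  "eval_word H f [] = \<one>\<^bsub>H\<^esub>"
  "eval_word H f ((x, True) # u) = f x \<otimes>\<^bsub>H\<^esub> eval_word H f u"
  "eval_word H f ((x, False) # u) = inv\<^bsub>H\<^esub> (f x) \<otimes>\<^bsub>H\<^esub> eval_word H f u"
  by (simp_all add: eval_word_def)

context group
begin

lemma eval_word_closed:
  assumes "f ` S \<subseteq> carrier G" "u \<in> lists (S \<times> UNIV)"
  shows "eval_word G f u \<in> carrier G"
  using assms(2)
proof (induction u)
  case (Cons p u)
  obtain x b where "p = (x, b)" by fastforce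
  then show ?case using Cons assms(1) by (cases b) (auto simp: image_subset_iff)
qed simp

lemma eval_word_append:
  assumes "f ` S \<subseteq> carrier G" "u \<in> lists (S \<times> UNIV)" "v \<in> lists (S \<times> UNIV)"
  shows "eval_word G f (u @ v) = eval_word G f u \<otimes> eval_word G f v"
  using assms(2)
proof (induction u)
  case Nil
  then show ?case using eval_word_closed[OF assms(1,3)] by simp
next
  case (Cons p u)
  obtain x b where p: "p = (x, b)" by fastforce
  have "f x \<in> carrier G" using Cons.hyps p assms(1) by auto
  then show ?case
    using p Cons.IH eval_word_closed[OF assms(1,3)] eval_word_closed[OF assms(1), of u] Cons.hyps
    by (cases b) (simp_all add: m_assoc)
qed

lemma eval_word_power:
  assumes "f ` S \<subseteq> carrier G" "u \<in> lists (S \<times> UNIV)"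
  shows "eval_word G f (concat (replicate n u)) = eval_word G f u [^] n"
proof (induction n)
  case (Suc n)
  have "concat (replicate n u) \<in> lists (S \<times> UNIV)"
    using assms(2) by (auto simp: in_lists_conv_set)
  then show ?case
    using Suc eval_word_append[OF assms] nat_pow_Suc2[OF eval_word_closed[OF assms], of n] by simp
qed simp

lemma generate_eval_word:
  assumes "f ` S \<subseteq> carrier G" "x \<in> generate G (f ` S)"
  shows "\<exists>u\<in>lists (S \<times> UNIV). x = eval_word G f u"
  using assms(2)
proof (induction x rule: generate.induct)
  case one
  then show ?case by (intro bexI[of _ "[]"]) auto
next
  case (incl h)
  then obtain s where "s \<in> S" "h = f s" by blast
  then show ?case using assms(1) by (intro bexI[of _ "[(s, True)]"]) auto
next
  case (inv h)
  then obtain s where "s \<in> S" "h = f s" by blast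
  then show ?case using assms(1) by (intro bexI[of _ "[(s, False)]"]) auto
next
  case (eng h1 h2)
  then obtain u v where "u \<in> lists (S \<times> UNIV)" "h1 = eval_word G f u"
    "v \<in> lists (S \<times> UNIV)" "h2 = eval_word G f v" by blast
  then show ?case
    using eval_word_append[OF assms(1)] by (intro bexI[of _ "u @ v"]) auto
qed

lemma power_commutes:
  assumes "x \<in> carrier G" "y \<in> carrier G" "x \<otimes> y = y \<otimes> x"
  shows "x [^] (n::nat) \<otimes> y = y \<otimes> x [^] n"
proof (induction n)
  case (Suc n)
  have "x [^] Suc n \<otimes> y = x [^] n \<otimes> (y \<otimes> x)" using assms by (simp add: m_assoc)
  also have "\<dots> = y \<otimes> x [^] Suc n" using Suc assms by (simp add: m_assoc[symmetric])
  finally show ?case .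
qed (use assms in simp)

text \<open>By Bezout \<open>x\<close> is a power of \<open>x [^] n\<close>; for
  \<open>n = 0\<close> coprimality makes \<open>x\<close> trivial.\<close>

lemma commutes_of_power_commutes:
  assumes x: "x \<in> carrier G" and y: "y \<in> carrier G" and o: "ord x \<noteq> 0" "coprime (ord x) n"
    and c: "x [^] (n::nat) \<otimes> y = y \<otimes> x [^] n"
  shows "x \<otimes> y = y \<otimes> x"
proof (cases "n = 0")
  case True
  then have "x = \<one>" using o x pow_ord_eq_1[OF x] by simp
  then show ?thesis using y by simp
next
  case False
  obtain i j where ij: "n * i = ord x * j + 1"
    using bezout_nat[OF False, of "ord x"] o(2)
    by (auto simp: coprime_iff_gcd_eq_1 gcd.commute)
  have "(x [^] n) [^] i = x [^] (ord x * j + 1)" using x by (simp add: nat_pow_pow ij)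
  also have "\<dots> = x" using x by (simp add: nat_pow_mult[symmetric] nat_pow_pow[symmetric])
  finally show ?thesis
    using power_commutes[of "x [^] n" y i] x y c by simp
qed

end

text \<open>Each defining relation is a commuting square. A row of such squares moves the letter
  from the right of the word to its left, leaving the residual of the word behind.\<close>

lemma (in group) eval_word_crossing:
  assumes inv: "invertible_automaton B"
    and f: "f ` states B \<subseteq> carrier G" and g: "g ` alphabet B \<subseteq> carrier G"
    and rel: "\<And>q l. q \<in> states B \<Longrightarrow> l \<in> alphabet B \<Longrightarrow>
      f q \<otimes> g (out_letter B q l) = g l \<otimes> f (next_state B q l)"
    and u: "u \<in> lists (states (sym_automaton B))" and l: "l \<in> alphabet B"
  shows "eval_word G f u \<otimes> g (fold (out_letter (sym_automaton B)) u l)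
    = g l \<otimes> eval_word G f (action (dual_automaton (sym_automaton B)) l u)"
  using u l
proof (induction u arbitrary: l)
  case Nil
  then show ?case using g by (simp add: image_subset_iff)
next
  case (Cons p u)
  let ?E = "sym_automaton B"
  obtain q b where p: "p = (q, b)" by fastforce
  have m: "mealy_automaton ?E" using invertible_mealy[OF sym_invertible[OF inv]] .
  have q: "q \<in> states B" and u: "u \<in> lists (states ?E)" using Cons.hyps p by auto
  let ?s = "\<lambda>x c. if c then f x else inv (f x)"
  define l' where "l' = out_letter ?E p l"
  have pE: "p \<in> states ?E" "l \<in> alphabet ?E" using Cons.hyps Cons.prems by auto
  have l': "l' \<in> alphabet B" using m pE by (auto simp: mealy_automaton_def l'_def)
  obtain q' where q': "next_state ?E p l = (q', b)" "q' \<in> states B"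
  proof -
    have "next_state ?E p l \<in> states ?E" using m pE unfolding mealy_automaton_def by blast
    moreover have "snd (next_state ?E p l) = b" using p by (cases b) simp_all
    ultimately show ?thesis using that by (cases "next_state ?E p l") auto
  qed
  have gs: "g l \<in> carrier G" "g l' \<in> carrier G" and fs: "f q \<in> carrier G" "f q' \<in> carrier G"
    using f g l' Cons.prems q q' by auto
  have step: "?s q b \<otimes> g l' = g l \<otimes> ?s q' b"
  proof (cases b)
    case True
    then show ?thesis using rel[OF q Cons.prems] q' p by (auto simp: l'_def)
  next
    case False
    have l'': "l' = inv_into (alphabet B) (out_letter B q) l" using False p by (simp add: l'_def)
    have "out_letter B q l' = l" using inv_out_letter(2)[OF inv q Cons.prems] l'' by simp
    moreover have "next_state B q l' = q'" using q'(1) False p l'' by simp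
    \<comment> \<open>For the inverse of \<open>q\<close> the square at the preimage
      \<open>l'\<close> is used, multiplied by \<open>inv (f q)\<close> on the left and by
      \<open>inv (f q')\<close> on the right.\<close>
    ultimately have "f q \<otimes> g l = g l' \<otimes> f q'" using rel[OF q l'] by simp
    then have "inv (f q) \<otimes> (f q \<otimes> g l) \<otimes> inv (f q') = inv (f q) \<otimes> (g l' \<otimes> f q') \<otimes> inv (f q')"
      by simp
    moreover have "inv (f q) \<otimes> (f q \<otimes> g l) = g l"
      using fs gs by (simp add: m_assoc[symmetric])
    moreover have "inv (f q) \<otimes> (g l' \<otimes> f q') \<otimes> inv (f q') = inv (f q) \<otimes> g l'"
      using fs gs by (simp add: m_assoc)
    ultimately show ?thesis using False by simp
  qed
  have sc: "?s q b \<in> carrier G" "?s q' b \<in> carrier G" using fs by simp_all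
  let ?u' = "action (dual_automaton ?E) l' u"
  have "?u' \<in> lists (states B \<times> UNIV)"
    using action_in_lists[OF dual_mealy[OF m], of l' u] u l' by simp
  then have uc: "eval_word G f u \<in> carrier G" "eval_word G f ?u' \<in> carrier G"
    using eval_word_closed[OF f] u by simp_all
  let ?x = "g (fold (out_letter ?E) u l')"
  have IH: "eval_word G f u \<otimes> ?x = g l' \<otimes> eval_word G f ?u'"
    using Cons.IH[OF l'] .
  have "fold (out_letter ?E) u l' \<in> alphabet B"
    using bij_betw_apply[OF bij_fold_out[OF sym_invertible[OF inv] u], of l'] l' by simp
  then have xc: "?x \<in> carrier G" using g by auto
  have "eval_word G f (p # u) \<otimes> ?x = ?s q b \<otimes> (eval_word G f u \<otimes> ?x)"
    using p uc xc fs by (cases b) (simp_all add: m_assoc)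
  also have "\<dots> = (?s q b \<otimes> g l') \<otimes> eval_word G f ?u'"
    using IH sc gs uc by (simp add: m_assoc del: if_split)
  also have "\<dots> = g l \<otimes> (?s q' b \<otimes> eval_word G f ?u')"
    unfolding step using sc gs uc by (simp add: m_assoc)
  also have "\<dots> = g l \<otimes> eval_word G f (action (dual_automaton ?E) l (p # u))"
    using q'(1) by (cases b) (simp_all add: l'_def)
  finally show ?case by (simp add: l'_def)
qed

text \<open>A word acting trivially fixes every letter, so crossing becomes commutation up to
  replacing the word by its residual, which acts trivially again. Conjugation by letters thus
  permutes trivial words, in the way \<open>D\<close> acts.\<close>

lemma trivial_word_conjugate:
  fixes B :: "('q, 'l) mealy" and H (structure)
  defines "E \<equiv> sym_automaton B"
  defines "D \<equiv> sym_automaton (dual_automaton E)"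
  assumes B: "bireversible_automaton B" and "group H"
    and f: "f ` states B \<subseteq> carrier H" and g: "g ` alphabet B \<subseteq> carrier H"
    and rel: "\<And>q l. q \<in> states B \<Longrightarrow> l \<in> alphabet B \<Longrightarrow>
      f q \<otimes> g (out_letter B q l) = g l \<otimes> f (next_state B q l)"
    and b: "b \<in> lists (alphabet B \<times> UNIV)"
    and u: "u \<in> lists (states E)" "word_equiv E u []"
  shows "eval_word H f u \<otimes> eval_word H g b = eval_word H g b \<otimes> eval_word H f (word_action D b u)"
  using b u
proof (induction b arbitrary: u)
  case Nil
  interpret group H by fact
  show ?case using Nil eval_word_closed[OF f, of u] by (simp add: E_def)
next
  case (Cons p b)
  interpret group H by fact
  have inv: "invertible_automaton B" using B by (simp add: bireversible_automaton_def)
  have invE: "invertible_automaton E" unfolding E_def by (rule sym_invertible[OF inv])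
  have revE: "invertible_automaton (dual_automaton E)" unfolding E_def by (rule sym_reversible[OF B])
  have mD: "mealy_automaton D" unfolding D_def by (rule invertible_mealy[OF sym_invertible[OF revE]])
  obtain l c where p: "p = (l, c)" by fastforce
  have l: "l \<in> alphabet B" and b: "b \<in> lists (alphabet B \<times> UNIV)" using Cons.hyps p by auto
  have gl: "g l \<in> carrier H" using g l by auto
  let ?u = "action D p u"
  have triv: "eval_word H f v \<otimes> g l = g l \<otimes> eval_word H f (action (dual_automaton E) l v)"
    "word_equiv E (action (dual_automaton E) l v) []"
    if v: "v \<in> lists (states E)" "word_equiv E v []" for v
  proof -
    have "word_action E v [l] = [l]" using v(2) l by (simp add: word_equiv_def E_def)
    then show "eval_word H f v \<otimes> g l = g l \<otimes> eval_word H f (action (dual_automaton E) l v)"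
      using eval_word_crossing[OF inv f g rel, of v l] v(1) l
      by (simp add: E_def word_action_single)
    have "[l] \<in> lists (alphabet E)" using l by (simp add: E_def)
    from word_equiv_residual[OF v(2) this]
    show "word_equiv E (action (dual_automaton E) l v) []" by (simp add: word_action_Cons)
  qed
  have uX: "?u \<in> lists (states E)"
    using action_in_lists[OF mD, of p u] Cons.prems(1) p l by (simp add: D_def E_def)
  have "word_equiv E ?u [] \<and>
    eval_word H f u \<otimes> eval_word H g [p] = eval_word H g [p] \<otimes> eval_word H f ?u"
  proof (cases c)
    case True
    then have "?u = action (dual_automaton E) l u" using p by (simp add: D_def action_sym_True)
    then show ?thesis using triv[OF Cons.prems] p True gl by simp
  next
    case False
    let ?a = "action (dual_automaton E) l"
    have au: "?a ?u = u"
      using action_sym_False(1)[OF revE, of l u] l Cons.prems(1) p False by (simp add: D_def E_def)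
    \<comment> \<open>An inverse letter calls for the preimage of \<open>u\<close> under
      \<open>?a\<close>. The trivial words of a fixed length form a finite set mapped injectively
      into itself, hence onto itself, so this preimage is trivial too.\<close>
    let ?W = "{v \<in> lists (states E). length v = length u \<and> word_equiv E v []}"
    have "finite (states E)" using invertible_mealy[OF invE] by (simp add: mealy_automaton_def)
    then have "finite {v. set v \<subseteq> states E \<and> length v = length u}" by (rule finite_lists_length_eq)
    then have finW: "finite ?W" by (rule finite_subset[rotated]) (auto simp: lists_eq_set)
    have inj: "inj_on ?a (lists (states E))"
      using bij_betw_imp_inj_on[OF bij_betw_action[OF revE, of l]] l by (simp add: E_def)
    have "?a ` ?W \<subseteq> ?W"
      using triv(2) bij_betw_apply[OF bij_betw_action[OF revE, of l]] l by (fastforce simp: E_def)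
    then have "?a ` ?W = ?W"
      using endo_inj_surj[OF finW] inj_on_subset[OF inj, of ?W] by blast
    moreover have "u \<in> ?W" using Cons.prems by simp
    ultimately obtain v where v: "v \<in> ?W" "?a v = u" by (metis (no_types, lifting) imageE)
    then have "v = ?u" using inj_onD[OF inj] au uX by (metis (mono_tags, lifting) mem_Collect_eq)
    then have eu: "word_equiv E ?u []" using v by simp
    have c: "eval_word H f ?u \<otimes> g l = g l \<otimes> eval_word H f u"
      using triv(1)[OF uX eu] au by simp
    have cl: "eval_word H f ?u \<in> carrier H" "eval_word H f u \<in> carrier H"
      using eval_word_closed[OF f] uX Cons.prems(1) by (simp_all add: E_def)
    have "inv (g l) \<otimes> (eval_word H f ?u \<otimes> g l) \<otimes> inv (g l)
        = inv (g l) \<otimes> (g l \<otimes> eval_word H f u) \<otimes> inv (g l)"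
      using c by simp
    moreover have "inv (g l) \<otimes> (eval_word H f ?u \<otimes> g l) \<otimes> inv (g l) = inv (g l) \<otimes> eval_word H f ?u"
      using gl cl by (simp add: m_assoc)
    moreover have "inv (g l) \<otimes> (g l \<otimes> eval_word H f u) = eval_word H f u"
      using gl cl by (simp add: m_assoc[symmetric])
    ultimately show ?thesis using eu p False gl by simp
  qed
  then have eu: "word_equiv E ?u []"
    and c: "eval_word H f u \<otimes> eval_word H g [p] = eval_word H g [p] \<otimes> eval_word H f ?u"
    by blast+
  have pX: "[p] \<in> lists (alphabet B \<times> UNIV)" using p l by simp
  have "word_action D b ?u \<in> lists (states E)"
    using word_action_in_lists[OF mD, of b ?u] b uX by (simp add: D_def E_def)
  then have cl: "eval_word H g [p] \<in> carrier H" "eval_word H g b \<in> carrier H"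
    "eval_word H f u \<in> carrier H" "eval_word H f ?u \<in> carrier H"
    "eval_word H f (word_action D b ?u) \<in> carrier H"
    using eval_word_closed[OF g] eval_word_closed[OF f] pX b uX Cons.prems(1)
    by (simp_all del: eval_word_simps add: E_def)
  have e: "eval_word H g (p # b) = eval_word H g [p] \<otimes> eval_word H g b"
    using eval_word_append[OF g pX b] by simp
  have "eval_word H f u \<otimes> eval_word H g (p # b) = (eval_word H f u \<otimes> eval_word H g [p]) \<otimes> eval_word H g b"
    unfolding e using cl by (simp add: m_assoc del: eval_word_simps)
  also have "\<dots> = eval_word H g [p] \<otimes> (eval_word H f ?u \<otimes> eval_word H g b)"
    unfolding c using cl by (simp add: m_assoc del: eval_word_simps)
  also have "\<dots> = eval_word H g [p] \<otimes> (eval_word H g b \<otimes> eval_word H f (word_action D b ?u))"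
    using Cons.IH[OF uX eu] by simp
  also have "\<dots> = eval_word H g (p # b) \<otimes> eval_word H f (word_action D (p # b) u)"
    unfolding e word_action_Cons using cl by (simp add: m_assoc del: eval_word_simps)
  finally show ?case .
qed

text \<open>If the least exponent \<open>i\<close> shared a divisor \<open>p > 1\<close> with
  \<open>m\<close>, then on every input the word repeated \<open>i / p\<close> times would have an
  orbit length dividing both \<open>p\<close> and a power of \<open>n\<close>. It would act
  trivially, against minimality.\<close>

lemma least_torsion_coprime:
  assumes inv: "invertible_automaton A" and rev: "mealy_automaton (dual_automaton A)"
    and u: "u \<in> lists (states A)"
    and n: "\<And>v l. v \<in> lists (states A) \<Longrightarrow> l \<in> alphabet A \<Longrightarrow>
      word_action A (concat (replicate n v)) [l] = [l]"
    and m: "coprime m n"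
    and tor: "N > 0" "word_equiv A (concat (replicate N u)) []"
  obtains i where "i > 0" "word_equiv A (concat (replicate i u)) []" "coprime m i"
proof -
  let ?P = "\<lambda>i. i > 0 \<and> word_equiv A (concat (replicate i u)) []"
  define i where "i = (LEAST i. ?P i)"
  have i: "?P i" unfolding i_def by (rule LeastI[of ?P N]) (use tor in simp)
  have "coprime m i"
  proof (rule ccontr)
    assume "\<not> coprime m i"
    define p where "p = gcd m i"
    have p: "p > 1" "p dvd m" "p dvd i"
      using i \<open>\<not> coprime m i\<close> by (simp_all add: p_def coprime_iff_gcd_eq_1 nat_neq_iff)
    obtain j where j: "i = p * j" using p(3) by (elim dvdE)
    have j0: "0 < j" "j < i" using i j p(1) by auto
    let ?v = "concat (replicate j u)"
    have v: "?v \<in> lists (states A)" using u by (auto simp: in_lists_conv_set)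
    have "word_action A ?v w = w" if w: "w \<in> lists (alphabet A)" for w
    proof (rule funpow_coprime_fixed)
      have "concat (replicate p ?v) = concat (replicate i u)"
        by (simp add: concat_replicate_mult j mult.commute)
      then show "(word_action A ?v ^^ p) w = w"
        using i w by (simp add: word_equiv_def word_action_concat_replicate[symmetric])
      show "(word_action A ?v ^^ (n ^ length w)) w = w"
        unfolding word_action_concat_replicate[symmetric]
        by (rule word_action_order_power[OF inv v w n rev])
      have "coprime p n" by (rule coprime_divisors[OF p(2) dvd_refl m])
      then show "coprime p (n ^ length w)" by simp
      show "p \<noteq> 0" using p(1) by simp
    qed
    then have "?P j" using j0 by (simp add: word_equiv_def)
    then show False using j0(2) not_less_Least unfolding i_def by blast
  qed
  then show thesis using that i by blast
qed

text \<open>The letters of \<open>D\<close> are signed states of \<open>B\<close>. Positive ones are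
  moved through the local group of \<open>dual_automaton B\<close>, negative ones through that of
  \<open>dual_automaton (inverse_automaton B)\<close>; the product of the two orders annihilates
  both.\<close>

lemma residual_local_order:
  fixes B :: "('q, 'l) mealy"
  defines "D \<equiv> sym_automaton (dual_automaton (sym_automaton B))"
  assumes B: "bireversible_automaton B"
    and v: "v \<in> lists (states D)" and x: "x \<in> alphabet D"
  shows "word_action D (concat (replicate
    (perm_order (dual_automaton B) * perm_order (dual_automaton (inverse_automaton B))) v)) [x] = [x]"
proof -
  let ?C = "dual_automaton (sym_automaton B)"
  let ?n1 = "perm_order (dual_automaton B)"
  let ?n2 = "perm_order (dual_automaton (inverse_automaton B))"
  have C: "invertible_automaton ?C" by (rule sym_reversible[OF B])
  have multiple: "(word_action D v ^^ (n * m)) [x] = [x]"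
    if "word_action D (concat (replicate n v)) [x] = [x]" for n m
  proof -
    have "((word_action D v ^^ n) ^^ m) [x] = [x]"
      using that by (induction m) (auto simp: word_action_concat_replicate)
    then show ?thesis by (simp add: funpow_mult mult.commute)
  qed
  obtain q c where qc: "x = (q, c)" "q \<in> states B" using x by (auto simp: D_def)
  show ?thesis
  proof (cases c)
    case True
    have "word_action D (concat (replicate ?n1 v)) [(q, True)] = [(q, True)]"
      unfolding D_def
      by (rule local_order[of "dual_automaton B" ?C "\<lambda>q. (q, True)"])
        (use bireversible_associated_invertible(2)[OF B] C v qc in \<open>auto simp: D_def\<close>)
    then show ?thesis
      using multiple[of ?n1 ?n2] qc True by (simp add: word_action_concat_replicate)
  next
    case False
    have "word_action D (concat (replicate ?n2 v)) [(\<lambda>p. (orig_state p, False)) (Inv q)]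
        = [(\<lambda>p. (orig_state p, False)) (Inv q)]"
      unfolding D_def
      by (rule local_order[of "dual_automaton (inverse_automaton B)" ?C "\<lambda>p. (orig_state p, False)"])
        (use bireversible_associated_invertible(3)[OF B] C v qc in
          \<open>auto simp: D_def inverse_automaton_def\<close>)
    then show ?thesis
      using multiple[of ?n2 ?n1] qc False by (simp add: word_action_concat_replicate mult.commute)
  qed
qed

text \<open>Torsion of \<open>a\<close> would make powers of \<open>x\<close> and \<open>y\<close>
  commute whose exponents are prime to the respective orders, and then \<open>x\<close> and
  \<open>y\<close> themselves would commute.\<close>

lemma word_infinite_order:
  fixes B :: "('q, 'l) mealy" and H (structure)
  assumes B: "bireversible_automaton B" and H: "group H"
    and f: "f ` states B \<subseteq> carrier H" and g: "g ` alphabet B \<subseteq> carrier H"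
    and rel: "\<And>q l. q \<in> states B \<Longrightarrow> l \<in> alphabet B \<Longrightarrow>
      f q \<otimes> g (out_letter B q l) = g l \<otimes> f (next_state B q l)"
    and a: "a \<in> lists (states B \<times> UNIV)" "x = eval_word H f a"
    and b: "b \<in> lists (alphabet B \<times> UNIV)" "y = eval_word H g b"
    and nc: "x \<otimes> y \<noteq> y \<otimes> x"
    and x: "group.ord H x \<noteq> 0" "coprime (group.ord H x) (perm_order B)"
    and y: "group.ord H y \<noteq> 0" "coprime (group.ord H y)
      (perm_order (dual_automaton B) * perm_order (dual_automaton (inverse_automaton B)))"
    and N: "N > 0"
  shows "\<not> word_equiv (sym_automaton B) (concat (replicate N a)) []"
proof
  interpret group H by fact
  let ?E = "sym_automaton B" and ?D = "sym_automaton (dual_automaton (sym_automaton B))"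
  let ?n = "perm_order (dual_automaton B) * perm_order (dual_automaton (inverse_automaton B))"
  assume tor: "word_equiv ?E (concat (replicate N a)) []"
  have inv: "invertible_automaton B" using B by (simp add: bireversible_automaton_def)
  have invE: "invertible_automaton ?E" by (rule sym_invertible[OF inv])
  have revE: "invertible_automaton (dual_automaton ?E)" by (rule sym_reversible[OF B])
  have invD: "invertible_automaton ?D" by (rule sym_invertible[OF revE])
  have aE: "a \<in> lists (states ?E)" using a by simp
  have nE: "word_action ?E (concat (replicate (perm_order B) v)) [l] = [l]"
    if "v \<in> lists (states ?E)" "l \<in> alphabet ?E" for v l
    using local_order[OF inv inv HOL.refl, of "\<lambda>x. x" v l] that by simp
  obtain i where i: "i > 0" "word_equiv ?E (concat (replicate i a)) []" "coprime (ord x) i"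
    by (rule least_torsion_coprime[OF invE invertible_mealy[OF revE] aE nE x(2) N tor])
  define u where "u = concat (replicate i a)"
  have u: "u \<in> lists (states ?E)" using aE by (auto simp: u_def in_lists_conv_set)
  \<comment> \<open>This power of \<open>b\<close> fixes \<open>u\<close> under the action of
    \<open>D\<close>, so conjugating by it does not change the value of \<open>u\<close>. As a power
    of \<open>?n\<close>, the exponent is prime to \<open>ord y\<close>.\<close>
  define j where "j = ?n ^ length u"
  have bj: "concat (replicate j b) \<in> lists (alphabet B \<times> UNIV)"
    using b by (auto simp: in_lists_conv_set)
  have "word_action ?D (concat (replicate j b)) u = u"
    unfolding j_def
    by (rule word_action_order_power[OF invD _ _ residual_local_order[OF B]])
      (use b u dual_mealy[OF invertible_mealy[OF invD]] in simp_all)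
  then have "eval_word H f u \<otimes> eval_word H g (concat (replicate j b))
      = eval_word H g (concat (replicate j b)) \<otimes> eval_word H f u"
    using trivial_word_conjugate[OF B H f g rel bj u] i(2) by (simp add: u_def)
  then have c: "x [^] i \<otimes> y [^] j = y [^] j \<otimes> x [^] i"
    using eval_word_power[OF f a(1)] eval_word_power[OF g b(1)] a b by (simp add: u_def)
  have cl: "x \<in> carrier H" "y \<in> carrier H"
    using eval_word_closed[OF f a(1)] eval_word_closed[OF g b(1)] a b by simp_all
  have "x \<otimes> y [^] j = y [^] j \<otimes> x"
    by (rule commutes_of_power_commutes[OF cl(1) _ x(1) i(3) c]) (use cl in simp)
  moreover have "coprime (ord y) j" using y(2) by (simp add: j_def)
  ultimately have "y \<otimes> x = x \<otimes> y"
    using commutes_of_power_commutes[OF cl(2,1) y(1)] by simp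
  then show False using nc by simp
qed

section \<open>Free semigroups in groups\<close>

lemma list_prod_simps [simp]:
  "list_prod G [] = \<one>\<^bsub>G\<^esub>" "list_prod G (x # xs) = x \<otimes>\<^bsub>G\<^esub> list_prod G xs"
  by (simp_all add: list_prod_def)

text \<open>Injectivity includes the empty word, so the pair generates a free monoid, and positive
  powers of \<open>x\<close> differ from the unit.\<close>

definition free_monoid_pair :: "('a, 'b) monoid_scheme \<Rightarrow> 'a \<Rightarrow> 'a \<Rightarrow> bool" where
  "free_monoid_pair G x y \<longleftrightarrow> x \<in> carrier G \<and> y \<in> carrier G \<and> x \<noteq> y
     \<and> inj_on (list_prod G) (lists {x, y})"

context group
begin

lemma list_prod_closed: "xs \<in> lists (carrier G) \<Longrightarrow> list_prod G xs \<in> carrier G"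
  by (induction xs) auto

lemma list_prod_append:
  assumes "xs \<in> lists (carrier G)" "ys \<in> lists (carrier G)"
  shows "list_prod G (xs @ ys) = list_prod G xs \<otimes> list_prod G ys"
  using assms(1) by (induction xs) (use list_prod_closed assms(2) in \<open>auto simp: m_assoc\<close>)

lemma free_monoid_pair_semigroup:
  assumes "free_monoid_pair G x y"
  shows "contains_nonabelian_free_semigroup G"
proof -
  have xy: "x \<in> carrier G" "y \<in> carrier G" "x \<noteq> y" and inj: "inj_on (list_prod G) (lists {x, y})"
    using assms by (simp_all add: free_monoid_pair_def)
  have "freely_generates_semigroup G {x, y}"
    using xy inj inj_on_subset[OF inj, of "lists {x, y} - {[]}"]
    by (auto simp: freely_generates_semigroup_def)
  moreover have "x \<in> semigroup_generated G {x, y}" "y \<in> semigroup_generated G {x, y}"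
    unfolding semigroup_generated_def using xy
    by (auto intro!: image_eqI[of x _ "[x]"] image_eqI[of y _ "[y]"])
  moreover have "x \<otimes> y \<noteq> y \<otimes> x"
  proof
    assume "x \<otimes> y = y \<otimes> x"
    then have "list_prod G [x, y] = list_prod G [y, x]" using xy by simp
    then show False using inj_onD[OF inj, of "[x, y]" "[y, x]"] xy(3) by auto
  qed
  ultimately show ?thesis unfolding contains_nonabelian_free_semigroup_def by blast
qed

lemma free_monoid_pair_infinite_order:
  assumes "free_monoid_pair G x y"
  shows "contains_infinite_order_element G"
proof -
  have x: "x \<in> carrier G" and inj: "inj_on (list_prod G) (lists {x, y})"
    using assms by (simp_all add: free_monoid_pair_def)
  have pow: "list_prod G (replicate n x) = x [^] n" for n
    by (induction n) (use x nat_pow_Suc2 in auto)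
  have "x [^] n \<noteq> \<one>" if "n \<noteq> 0" for n :: nat
  proof
    assume "x [^] n = \<one>"
    then have "list_prod G (replicate n x) = list_prod G []" by (simp add: pow)
    moreover have "replicate n x \<in> lists {x, y}" by (auto simp: in_lists_conv_set)
    ultimately have "replicate n x = []" using inj_onD[OF inj] by blast
    then show False using that by simp
  qed
  then show ?thesis
    unfolding contains_infinite_order_element_def using ord_eq_0[OF x] x by blast
qed

lemma generate_list_prod:
  assumes "S \<subseteq> carrier G" "x \<in> generate G S"
  shows "\<exists>w\<in>lists (S \<union> m_inv G ` S). x = list_prod G w"
  using assms(2)
proof (induction x rule: generate.induct)
  case one
  then show ?case by (intro bexI[of _ "[]"]) auto
next
  case (incl h)
  then show ?case using assms(1) by (intro bexI[of _ "[h]"]) auto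
next
  case (inv h)
  then show ?case using assms(1) by (intro bexI[of _ "[inv h]"]) auto
next
  case (eng h1 h2)
  then obtain u v where uv: "u \<in> lists (S \<union> m_inv G ` S)" "h1 = list_prod G u"
    "v \<in> lists (S \<union> m_inv G ` S)" "h2 = list_prod G v" by blast
  have "lists (S \<union> m_inv G ` S) \<subseteq> lists (carrier G)"
    using assms(1) by (intro lists_mono) auto
  then have "u \<in> lists (carrier G)" "v \<in> lists (carrier G)" using uv by blast+
  then have "h1 \<otimes> h2 = list_prod G (u @ v)" using uv list_prod_append by metis
  moreover have "u @ v \<in> lists (S \<union> m_inv G ` S)" using uv by simp
  ultimately show ?case by blast
qed

text \<open>Words of length \<open>m\<close> in \<open>x\<close> and \<open>y\<close> give
  \<open>2 ^ m\<close> distinct elements of the ball of radius \<open>K * m\<close>, where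
  \<open>K\<close> bounds the lengths of \<open>x\<close> and \<open>y\<close> over the given
  generators.\<close>

lemma free_monoid_pair_growth:
  assumes free: "free_monoid_pair G x y" and fin: "finite_generating_set G S0"
  shows "exponential_growth G"
  unfolding exponential_growth_def
proof (intro conjI allI impI)
  show "\<exists>S. finite_generating_set G S" using fin by blast
  fix S assume "finite_generating_set G S"
  then have S: "finite S" "S \<subseteq> carrier G" "generate G S = carrier G"
    by (simp_all add: finite_generating_set_def)
  have xy: "x \<in> carrier G" "y \<in> carrier G" "x \<noteq> y" and inj: "inj_on (list_prod G) (lists {x, y})"
    using free by (simp_all add: free_monoid_pair_def)
  let ?T = "S \<union> m_inv G ` S"
  let ?b = "\<lambda>n. card (word_ball G S n)"
  have T: "lists ?T \<subseteq> lists (carrier G)" using S(2) by (intro lists_mono) auto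
  have "{w \<in> lists ?T. length w \<le> n} = {w. set w \<subseteq> ?T \<and> length w \<le> n}" for n
    by (auto simp: lists_eq_set)
  then have finb: "finite (word_ball G S n)" for n
    unfolding word_ball_def using finite_lists_length_le[of ?T n] S(1) by simp
  obtain wx wy where w: "wx \<in> lists ?T" "x = list_prod G wx" "wy \<in> lists ?T" "y = list_prod G wy"
    using generate_list_prod[OF S(2)] S(3) xy by metis
  define K where "K = Suc (max (length wx) (length wy))"
  have K: "K > 0" "length wx \<le> K" "length wy \<le> K" by (auto simp: K_def)
  have mem: "\<exists>w\<in>lists ?T. length w \<le> K * length W \<and> list_prod G w = list_prod G W"
    if "W \<in> lists {x, y}" for W
    using that
  proof (induction W)
    case Nil
    show ?case by (intro bexI[of _ "[]"]) auto
  next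
    case (Cons z W)
    then obtain v where v: "v \<in> lists ?T" "length v \<le> K * length W" "list_prod G v = list_prod G W"
      by blast
    obtain u where u: "u \<in> lists ?T" "length u \<le> K" "z = list_prod G u"
      using Cons.hyps w K by blast
    have "list_prod G (u @ v) = list_prod G (z # W)"
      using u v T list_prod_append[of u v] by auto
    moreover have "u @ v \<in> lists ?T" "length (u @ v) \<le> K * length (z # W)"
      using u v by simp_all
    ultimately show ?case by blast
  qed
  have pow2: "2 ^ m \<le> ?b (K * m)" for m
  proof -
    let ?L = "{W. set W \<subseteq> {x, y} \<and> length W = m}"
    have sub: "?L \<subseteq> lists {x, y}" by (auto simp: lists_eq_set)
    have "2 ^ m = card ?L" using card_lists_length_eq[of "{x, y}" m] xy(3) by (simp add: numeral_2_eq_2)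
    also have "\<dots> = card (list_prod G ` ?L)"
      using card_image[OF inj_on_subset[OF inj sub]] by simp
    also have "\<dots> \<le> ?b (K * m)"
    proof (rule card_mono[OF finb], rule image_subsetI)
      fix W assume W: "W \<in> ?L"
      then obtain w where "w \<in> lists ?T" "length w \<le> K * m" "list_prod G w = list_prod G W"
        using mem[of W] sub by auto
      then have "w \<in> {w \<in> lists ?T. length w \<le> K * m}" "list_prod G W = list_prod G w" by simp_all
      then show "list_prod G W \<in> word_ball G S (K * m)"
        unfolding word_ball_def by (rule rev_image_eqI)
    qed
    finally show ?thesis .
  qed
  have mono: "?b m \<le> ?b n" if "m \<le> n" for m n
    using that by (intro card_mono[OF finb]) (auto simp: word_ball_def)
  have two: "2 \<le> ?b n" if "n > 0" for n
  proof -
    have "\<exists>s\<in>S. s \<noteq> \<one>"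
    proof (rule ccontr)
      assume "\<not> ?thesis"
      then have "S \<subseteq> {\<one>}" by blast
      then have "generate G S \<subseteq> {\<one>}" using mono_generate generate_one by metis
      then show False using S(3) xy by blast
    qed
    then obtain s where s: "s \<in> S" "s \<noteq> \<one>" by blast
    have "s \<in> word_ball G S n"
      unfolding word_ball_def using s that S(2) by (intro image_eqI[of _ _ "[s]"]) auto
    moreover have "\<one> \<in> word_ball G S n"
      unfolding word_ball_def by (intro image_eqI[of _ _ "[]"]) auto
    ultimately have "card {\<one>, s} \<le> ?b n" by (intro card_mono[OF finb]) auto
    then show ?thesis using s(2) by simp
  qed
  \<comment> \<open>The factor 2 in \<open>2 * K\<close> absorbs rounding:
    \<open>n \<le> 2 * K * (n div K)\<close> for \<open>n \<ge> K\<close>. For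
    \<open>0 < n < K\<close> the bound \<open>c ^ n \<le> 2\<close> suffices, as a ball of positive
    radius has at least two elements.\<close>
  define c where "c = root (2 * K) (2 :: real)"
  have c1: "c > 1" using K(1) by (simp add: c_def)
  have cK: "c ^ (2 * K) = 2" using K(1) by (simp add: c_def)
  have "c ^ n \<le> ?b n" for n
  proof (cases "n < K")
    case True
    show ?thesis
    proof (cases "n = 0")
      case True
      have "\<one> \<in> word_ball G S 0"
        unfolding word_ball_def by (intro image_eqI[of _ _ "[]"]) auto
      then have "card {\<one>} \<le> ?b 0" by (intro card_mono[OF finb]) auto
      then show ?thesis using True by simp
    next
      case False
      have "c ^ n \<le> c ^ (2 * K)" using c1 \<open>n < K\<close> by (intro power_increasing) auto
      also have "\<dots> \<le> ?b n" using cK two[of n] False by simp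
      finally show ?thesis .
    qed
  next
    case False
    define m where "m = n div K"
    have "n = K * m + n mod K" by (simp add: m_def)
    then have m: "K * m \<le> n" "n < K * m + K"
      using mod_less_divisor[OF K(1), of n] by linarith+
    have m1: "m \<ge> 1" using False K(1) by (simp add: m_def Suc_le_eq div_greater_zero_iff)
    have "K \<le> K * m" using m1 by simp
    then have "n \<le> K * m + K * m" using m(2) by linarith
    then have "n \<le> 2 * K * m" by (simp add: algebra_simps)
    then have "c ^ n \<le> c ^ (2 * K * m)" using c1 by (intro power_increasing) auto
    also have "\<dots> = 2 ^ m" unfolding power_mult[of c "2 * K" m] cK ..
    also have "\<dots> \<le> ?b (K * m)" using pow2[of m] by (metis of_nat_le_iff of_nat_numeral of_nat_power)
    also have "\<dots> \<le> ?b n" using mono[OF m(1)] by simp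
    finally show ?thesis .
  qed
  then show "\<exists>c>1. \<forall>n. c ^ n \<le> real (?b n)" using c1 by blast
qed

end

section \<open>The automaton group\<close>

lemma automaton_group_finite_generating_set:
  assumes "invertible_automaton A"
  shows "\<exists>S. finite_generating_set (automaton_group A) S"
proof -
  let ?S = "(\<lambda>q. restrict (action A q) (lists (alphabet A))) ` states A"
  note P = subgroup_of_BijGroup[where X = "lists (alphabet A)" and T = ?S, folded automaton_group_def]
  interpret group "automaton_group A" by (rule P(1))
  interpret BG: group "BijGroup (lists (alphabet A))" by (rule group_BijGroup)
  have S: "?S \<subseteq> carrier (automaton_group A)"
    using P(2) action_in_BijGroup[OF assms] by blast
  have "carrier (subgroup_generated (automaton_group A) ?S) = carrier (automaton_group A)"
    unfolding automaton_group_def by (simp only: BG.subgroup_generated2)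
  then have "generate (automaton_group A) ?S = carrier (automaton_group A)"
    using S by (simp add: carrier_subgroup_generated Int_absorb1)
  moreover have "finite ?S"
    using assms by (simp add: invertible_automaton_def mealy_automaton_def)
  ultimately show ?thesis using S unfolding finite_generating_set_def by blast
qed

lemma word_in_automaton_group:
  assumes A: "invertible_automaton A" and u: "u \<in> lists (states (sym_automaton A))"
  shows "restrict (word_action (sym_automaton A) u) (lists (alphabet A)) \<in> carrier (automaton_group A)"
  using u
proof (induction u)
  let ?W = "lists (alphabet A)"
  let ?S = "(\<lambda>q. restrict (action A q) ?W) ` states A"
  note P = subgroup_of_BijGroup[where X = ?W and T = ?S, folded automaton_group_def]
  interpret group "automaton_group A" by (rule P(1))
  {
    case Nil
    have "restrict (word_action (sym_automaton A) []) ?W = \<one>\<^bsub>automaton_group A\<^esub>"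
      unfolding P(5) by (rule restrict_ext) simp
    then show ?case using one_closed by metis
  next
    case (Cons p u)
    obtain q c where p: "p = (q, c)" by fastforce
    have q: "q \<in> states A" using Cons.hyps p by simp
    let ?g = "restrict (action A q) ?W"
    have g: "?g \<in> carrier (automaton_group A)"
      using P(2) action_in_BijGroup[OF A] q by blast
    have bij: "bij_betw (action A q) ?W ?W" by (rule bij_betw_action[OF A q])
    have pc: "restrict (action (sym_automaton A) p) ?W \<in> carrier (automaton_group A)"
    proof (cases c)
      case True
      then have "restrict (action (sym_automaton A) p) ?W = ?g"
        using p by (intro restrict_ext) (simp add: action_sym_True)
      then show ?thesis using g by simp
    next
      case False
      have "action (sym_automaton A) p w = inv_into ?W (action A q) w" if w: "w \<in> ?W" for w
      proof -
        have m: "action (sym_automaton A) p w \<in> ?W"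
          using action_in_lists[OF invertible_mealy[OF sym_invertible[OF A]], of p w] p q w by simp
        have "action A q (action (sym_automaton A) p w) = w"
          using action_sym_False(1)[OF A q w] p False by simp
        from inv_into_f_eq[OF bij_betw_imp_inj_on[OF bij] m this] show ?thesis by (rule HOL.sym)
      qed
      then have "restrict (action (sym_automaton A) p) ?W = inv\<^bsub>automaton_group A\<^esub> ?g"
        unfolding P(6)[OF g] by (intro restrict_ext) (simp add: restrict_inv_into del: in_lists_conv_set)
      then show ?thesis using g by simp
    qed
    have "restrict (word_action (sym_automaton A) (p # u)) ?W
        = restrict (word_action (sym_automaton A) u) ?W \<otimes>\<^bsub>automaton_group A\<^esub>
          restrict (action (sym_automaton A) p) ?W"
    proof -
      have "action (sym_automaton A) p w \<in> ?W" if "w \<in> ?W" for w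
        using action_in_lists[OF invertible_mealy[OF sym_invertible[OF A]], of p w] p q that by simp
      then show ?thesis
        unfolding P(4)[OF Cons.IH pc] compose_def
        by (intro restrict_ext) (simp add: word_action_Cons del: in_lists_conv_set)
    qed
    then show ?case using m_closed[OF Cons.IH pc] by metis
  }
qed

text \<open>In the power automaton for \<open>length a\<close> the word \<open>a\<close> is a single
  state, to which \<open>torsion_or_free\<close> applies. The pair it yields consists of words whose
  letters are themselves words of signed states, whence the double \<open>concat\<close>.\<close>

lemma automaton_group_free_pair:
  assumes B: "bireversible_automaton B"
    and a: "a \<in> lists (states B \<times> UNIV)"
    and inf: "\<And>N. N > 0 \<Longrightarrow> \<not> word_equiv (sym_automaton B) (concat (replicate N a)) []"
  shows "\<exists>x y. free_monoid_pair (automaton_group B) x y"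
proof -
  have inv: "invertible_automaton B" using B by (simp add: bireversible_automaton_def)
  let ?E = "sym_automaton B" and ?W = "lists (alphabet B)" and ?G = "automaton_group B"
  let ?A = "power_automaton ?E (length a)"
  have invE: "invertible_automaton ?E" by (rule sym_invertible[OF inv])
  have equiv: "word_equiv ?A us vs \<longleftrightarrow> word_equiv ?E (concat us) (concat vs)" for us vs
    by (simp add: word_equiv_def word_action_power)
  have "\<exists>u\<in>lists (states ?A). \<exists>v\<in>lists (states ?A). u \<noteq> v \<and>
      (\<forall>U\<in>lists {u, v}. \<forall>V\<in>lists {u, v}. word_equiv ?A (concat U) (concat V) \<longrightarrow> U = V)"
    by (rule torsion_or_free[OF power_invertible[OF invE sym_reversible[OF B]], of a])
      (use a inf in \<open>simp_all add: equiv\<close>)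
  then obtain u v where uv: "u \<in> lists (states ?A)" "v \<in> lists (states ?A)" "u \<noteq> v"
    and free: "\<And>U V. U \<in> lists {u, v} \<Longrightarrow> V \<in> lists {u, v} \<Longrightarrow>
      word_equiv ?E (concat (concat U)) (concat (concat V)) \<Longrightarrow> U = V"
    unfolding equiv by blast
  define F where "F s = restrict (word_action ?E (concat s)) ?W" for s
  note P = subgroup_of_BijGroup[where X = ?W and T = "(\<lambda>q. restrict (action B q) ?W) ` states B",
    folded automaton_group_def]
  interpret group ?G by (rule P(1))
  have cs: "concat s \<in> lists (states ?E)" if "s \<in> lists (states ?A)" for s
    using that by (auto simp: in_lists_conv_set)
  have Fc: "F s \<in> carrier ?G" if "s \<in> lists (states ?A)" for s
    unfolding F_def by (rule word_in_automaton_group[OF inv cs[OF that]])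
  have Fapp: "F (s @ t) = F t \<otimes>\<^bsub>?G\<^esub> F s"
    if st: "s \<in> lists (states ?A)" "t \<in> lists (states ?A)" for s t
  proof -
    have "word_action ?E (concat s) w \<in> ?W" if "w \<in> ?W" for w
      using word_action_in_lists[OF invertible_mealy[OF invE] cs[OF st(1)], of w] that by simp
    then show ?thesis
      unfolding P(4)[OF Fc[OF st(2)] Fc[OF st(1)]] compose_def
      by (simp add: F_def word_action_append del: in_lists_conv_set cong: restrict_cong)
  qed
  have concat_closed: "concat V \<in> lists (states ?A)" if "V \<in> lists {u, v}" for V
    using that
  proof (induction V)
    case (Cons s V)
    then have "s \<in> lists (states ?A)" using uv(1,2) by blast
    then show ?case using Cons.IH by (simp only: concat.simps append_in_lists_conv)
  qed simp
  \<comment> \<open>Group multiplication composes maps from right to left while words act from left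
    to right, so the factors are reversed. Reversal of lists is injective, and freeness
    survives.\<close>
  have Fprod: "list_prod ?G (map F U) = F (concat (rev U))" if "U \<in> lists {u, v}" for U
    using that
  proof (induction U)
    case Nil
    show ?case unfolding F_def by (simp add: P(5) restrict_def cong: if_cong)
  next
    case (Cons s U)
    have "s \<in> lists (states ?A)" using Cons.hyps uv by blast
    moreover have "concat (rev U) \<in> lists (states ?A)"
      by (rule concat_closed) (use Cons.hyps(2) in \<open>simp add: in_lists_conv_set\<close>)
    ultimately show ?case using Fapp Cons.IH by simp
  qed
  have Feq: "word_equiv ?E (concat s) (concat t)" if "F s = F t" for s t
    unfolding word_equiv_def
  proof
    fix w assume "w \<in> lists (alphabet ?E)"
    then show "word_action ?E (concat s) w = word_action ?E (concat t) w"
      using fun_cong[OF that, of w] by (simp add: F_def del: in_lists_conv_set)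
  qed
  have injF: "inj_on F {u, v}"
  proof (rule inj_onI)
    fix s t assume st: "s \<in> {u, v}" "t \<in> {u, v}" "F s = F t"
    then have "[s] = [t]" using free[of "[s]" "[t]"] Feq by simp
    then show "s = t" by simp
  qed
  have "inj_on (list_prod ?G) (lists {F u, F v})"
  proof (rule inj_onI)
    fix X Y assume X: "X \<in> lists {F u, F v}" and Y: "Y \<in> lists {F u, F v}"
      and eq: "list_prod ?G X = list_prod ?G Y"
    have "lists {F u, F v} = map F ` lists {u, v}" using lists_image[of F "{u, v}"] by simp
    then have "X \<in> map F ` lists {u, v}" "Y \<in> map F ` lists {u, v}" using X Y by simp_all
    then obtain U V where UV: "U \<in> lists {u, v}" "X = map F U" "V \<in> lists {u, v}" "Y = map F V"
      by (elim imageE)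
    have "F (concat (rev U)) = F (concat (rev V))"
      using eq unfolding UV(2,4) Fprod[OF UV(1)] Fprod[OF UV(3)] .
    then have "rev U = rev V"
      using UV(1,3) by (intro free Feq) (simp_all add: in_lists_conv_set)
    then show "X = Y" using UV by simp
  qed
  moreover have "F u \<noteq> F v" using injF uv(3) by (auto simp: inj_on_def)
  ultimately have "free_monoid_pair ?G (F u) (F v)"
    unfolding free_monoid_pair_def using Fc uv(1,2) by blast
  then show ?thesis by blast
qed

text \<open>Phrased through the images \<open>f\<close> and \<open>g\<close> of the generators in
  \<open>H\<close>, so that the dual automaton is covered by exchanging \<open>f\<close> and
  \<open>g\<close>, without relating its presented group to \<open>gamma_group B\<close>.\<close>

lemma automaton_group_conclusion:
  fixes B :: "('q, 'l) mealy" and H (structure)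
  assumes B: "bireversible_automaton B" and H: "group H"
    and f: "f ` states B \<subseteq> carrier H" and g: "g ` alphabet B \<subseteq> carrier H"
    and rel: "\<And>q l. q \<in> states B \<Longrightarrow> l \<in> alphabet B \<Longrightarrow>
      f q \<otimes> g (out_letter B q l) = g l \<otimes> f (next_state B q l)"
    and xy: "x \<in> generate H (f ` states B)" "y \<in> generate H (g ` alphabet B)"
    and nc: "x \<otimes> y \<noteq> y \<otimes> x"
    and x: "group.ord H x \<noteq> 0" "coprime (group.ord H x) (perm_order B)"
    and y: "group.ord H y \<noteq> 0" "coprime (group.ord H y)
      (perm_order (dual_automaton B) * perm_order (dual_automaton (inverse_automaton B)))"
  shows "contains_nonabelian_free_semigroup (automaton_group B)
    \<and> exponential_growth (automaton_group B)
    \<and> contains_infinite_order_element (automaton_group B)"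
proof -
  obtain a where a: "a \<in> lists (states B \<times> UNIV)" "x = eval_word H f a"
    using group.generate_eval_word[OF H f xy(1)] by blast
  obtain b where b: "b \<in> lists (alphabet B \<times> UNIV)" "y = eval_word H g b"
    using group.generate_eval_word[OF H g xy(2)] by blast
  obtain s t where st: "free_monoid_pair (automaton_group B) s t"
    using automaton_group_free_pair[OF B a(1)] word_infinite_order[OF B H f g rel a b nc x y] by blast
  have inv: "invertible_automaton B" using B by (simp add: bireversible_automaton_def)
  have G: "group (automaton_group B)"
    unfolding automaton_group_def by (rule subgroup_of_BijGroup(1))
  show ?thesis
    using group.free_monoid_pair_semigroup[OF G st] group.free_monoid_pair_infinite_order[OF G st]
      group.free_monoid_pair_growth[OF G st] automaton_group_finite_generating_set[OF inv] by blast
qed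

theorem corollary1p3:
  fixes B :: "('q, 'l) mealy"
    and H :: "('h, 'm) monoid_scheme"
    and \<phi> :: "('q + 'l) gword set \<Rightarrow> 'h"
    and \<gamma>Q \<gamma>L :: "('q + 'l) gword set"
  assumes "bireversible_automaton B"
    and "\<gamma>Q \<in> generate (gamma_group B) ((\<lambda>q. gamma_gen B (Inl q)) ` states B)"
    and "\<gamma>L \<in> generate (gamma_group B) ((\<lambda>l. gamma_gen B (Inr l)) ` alphabet B)"
    and "group H"
    and "\<phi> \<in> hom (gamma_group B) H"
    and "\<phi> \<gamma>Q \<otimes>\<^bsub>H\<^esub> \<phi> \<gamma>L \<noteq> \<phi> \<gamma>L \<otimes>\<^bsub>H\<^esub> \<phi> \<gamma>Q"
    and "group.ord H (\<phi> \<gamma>Q) \<noteq> 0"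
    and "coprime (group.ord H (\<phi> \<gamma>Q))
           (perm_order B * perm_order (dual_automaton (inverse_automaton (dual_automaton B))))"
    and "group.ord H (\<phi> \<gamma>L) \<noteq> 0"
    and "coprime (group.ord H (\<phi> \<gamma>L))
           (perm_order (dual_automaton B) * perm_order (dual_automaton (inverse_automaton B)))"
  shows "contains_nonabelian_free_semigroup (automaton_group B)
       \<and> contains_nonabelian_free_semigroup (automaton_group (dual_automaton B))
       \<and> exponential_growth (automaton_group B)
       \<and> exponential_growth (automaton_group (dual_automaton B))
       \<and> contains_infinite_order_element (automaton_group B)
       \<and> contains_infinite_order_element (automaton_group (dual_automaton B))"
proof -
  let ?\<Gamma> = "gamma_group B"
  define f where "f q = \<phi> (gamma_gen B (Inl q))" for q
  define g where "g l = \<phi> (gamma_gen B (Inr l))" for l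
  interpret group_hom ?\<Gamma> H \<phi>
    using group_gamma_group assms(4,5) by (simp add: group_hom_def group_hom_axioms_def)
  have gens: "gamma_gen B (Inl q) \<in> carrier ?\<Gamma>" if "q \<in> states B" for q
    using that by (intro gamma_gen_in_carrier) (simp add: gamma_gens_def)
  have gens': "gamma_gen B (Inr l) \<in> carrier ?\<Gamma>" if "l \<in> alphabet B" for l
    using that by (intro gamma_gen_in_carrier) (simp add: gamma_gens_def)
  have f: "f ` states B \<subseteq> carrier H" and g: "g ` alphabet B \<subseteq> carrier H"
    using gens gens' by (auto simp: f_def g_def)
  have inv: "invertible_automaton B" using assms(1) by (simp add: bireversible_automaton_def)
  have rel: "f q \<otimes>\<^bsub>H\<^esub> g (out_letter B q l) = g l \<otimes>\<^bsub>H\<^esub> f (next_state B q l)"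
    if ql: "q \<in> states B" "l \<in> alphabet B" for q l
  proof -
    have "out_letter B q l \<in> alphabet B" "next_state B q l \<in> states B"
      using invertible_mealy[OF inv] ql by (auto simp: mealy_automaton_def)
    then show ?thesis
      using arg_cong[OF gamma_relation[OF invertible_mealy[OF inv] ql], of \<phi>] gens gens' ql
      by (simp add: f_def g_def)
  qed
  have fimg: "f ` states B = \<phi> ` (\<lambda>q. gamma_gen B (Inl q)) ` states B"
    and gimg: "g ` alphabet B = \<phi> ` (\<lambda>l. gamma_gen B (Inr l)) ` alphabet B"
    by (auto simp: f_def g_def)
  have x: "\<phi> \<gamma>Q \<in> generate H (f ` states B)"
    unfolding fimg using generate_img[of "(\<lambda>q. gamma_gen B (Inl q)) ` states B"] gens assms(2) by blast
  have y: "\<phi> \<gamma>L \<in> generate H (g ` alphabet B)"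
    unfolding gimg using generate_img[of "(\<lambda>l. gamma_gen B (Inr l)) ` alphabet B"] gens' assms(3) by blast
  have cop: "coprime (group.ord H (\<phi> \<gamma>Q)) (perm_order B)"
    "coprime (group.ord H (\<phi> \<gamma>L)) (perm_order (dual_automaton B))"
    using assms(8,10) by auto
  have "contains_nonabelian_free_semigroup (automaton_group B)
    \<and> exponential_growth (automaton_group B)
    \<and> contains_infinite_order_element (automaton_group B)"
    by (rule automaton_group_conclusion[OF assms(1,4) f g rel x y assms(6,7) cop(1) assms(9,10)])
  \<comment> \<open>For the dual, states and letters change roles and each relation is read from
    right to left. As the dual of the dual is \<open>B\<close>, the order conditions trade places as
    well.\<close>
  moreover have "contains_nonabelian_free_semigroup (automaton_group (dual_automaton B))
    \<and> exponential_growth (automaton_group (dual_automaton B))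
    \<and> contains_infinite_order_element (automaton_group (dual_automaton B))"
    by (rule automaton_group_conclusion[OF dual_bireversible[OF assms(1)] assms(4), of g f "\<phi> \<gamma>L" "\<phi> \<gamma>Q"])
      (use f g rel[symmetric] x y assms(6-9) cop(2) in simp_all)
  ultimately show ?thesis by blast
qed

end
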